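(* Let $p$ be a prime, $h\ge1$, $q=p^{2h}$, and let $a_1,\dots,a_h$ be an $\mathbb{F}_p$-basis of $A=\{a\in\mathbb{F}_q: a^{p^h}+a=0\}$. Let $1\le t\le h$ and let $$B=\{(x,y_1,\dots,y_t)\in\mathbb{F}_q^{t+1}:\ y_i^p-y_i=a_ix^{p^h+1}\ \text{for all } i\in[t]\},$$ ordered as $Q_1,\dots,Q_n$. Let $l=q-tp^h+2tp^{h-1}-t$, $$V=\operatorname{Span}_{\mathbb{F}_q}\{x^jy_1^{e_1}\cdots y_t^{e_t}:\ 0\le j\le l,\ 0\le e_i\le p-2\},$$ and $C=\{(f(Q_1),\dots,f(Q_n)):f\in V\}$. Then $C$ is a linear $[n,k,d]$ code over $\mathbb{F}_q$ with availability $t$ and locality $(p-1,\dots,p-1)$ (the $j$-th recovery set of the position of $(\alpha,\beta_1,\dots,\beta_t)$ consisting of the other points of $B$ with $x=\alpha$ and $y_k=\beta_k$ for all $k\ne j$), where $$n=p^tq,\qquad k=(q-tp^h+2tp^{h-1}-t+1)(p-1)^t,\qquad d\ge 2tp^{t-1}.$$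
   Context: This is the code $C(l\infty_x,B)$ on the fiber product over $\mathbb{P}^1_x$ of the Artin–Schreier curves $\mathcal{Y}_{a_i}: y^p-y=a_ix^{p^h+1}$, $i\in[t]$, with $B$ the affine $\mathbb{F}_q$-rational points. A linear code of length $n$ has availability $t$ and locality $(r_1,\dots,r_t)$ if each position $i$ has pairwise disjoint sets $A_{i1},\dots,A_{it}\subseteq[n]\setminus\{i\}$ with $|A_{ij}|=r_j$ such that the $i$-th entry of every codeword is a function of its entries on $A_{ij}$, for each $j$. *)

theory Defs
  imports
    Complex_Main
    "HOL-Library.FuncSet"
    "HOL-Library.Disjoint_Sets"
    "HOL-Library.Cardinality"
    "HOL-Library.Function_Algebras"
    "HOL-Computational_Algebra.Primes"
begin

definition fun_scale :: "'a::field \<Rightarrow> ('b \<Rightarrow> 'a) \<Rightarrow> 'b \<Rightarrow> 'a" where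
  "fun_scale c f = (\<lambda>x. c * f x)"

global_interpretation fun_vs: vector_space "fun_scale :: 'a::field \<Rightarrow> ('b \<Rightarrow> 'a) \<Rightarrow> 'b \<Rightarrow> 'a"
  by standard (simp_all add: fun_scale_def fun_eq_iff algebra_simps)

text \<open>The image of the integers is a copy of the field with $p$ elements whenever the
  characteristic is the prime $p$.\<close>

definition prime_subfield :: "'a::field set" where
  "prime_subfield = range of_int"

definition basis_over :: "'a::field set \<Rightarrow> 'a set \<Rightarrow> 'i set \<Rightarrow> ('i \<Rightarrow> 'a) \<Rightarrow> bool" where
  "basis_over K S I a \<longleftrightarrow>
     S = {\<Sum>i\<in>I. c i * a i | c. c \<in> I \<rightarrow> K} \<and>
     (\<forall>c \<in> I \<rightarrow> K. (\<Sum>i\<in>I. c i * a i) = 0 \<longrightarrow> (\<forall>i\<in>I. c i = 0))"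

text \<open>A point $(x, y_1, \dots, y_t)$ is a pair of $x$ and a function on $\{1,\dots,t\}$;
  extensionality makes this representation unique.\<close>

type_synonym 'a point = "'a \<times> (nat \<Rightarrow> 'a)"

definition affine_points :: "nat \<Rightarrow> nat \<Rightarrow> nat \<Rightarrow> (nat \<Rightarrow> 'a::field) \<Rightarrow> 'a point set" where
  "affine_points p h t a =
     {(x, y). y \<in> {1..t} \<rightarrow>\<^sub>E UNIV \<and> (\<forall>i\<in>{1..t}. y i ^ p - y i = a i * x ^ (p ^ h + 1))}"

definition monomial :: "nat \<Rightarrow> nat \<Rightarrow> (nat \<Rightarrow> nat) \<Rightarrow> 'a::field point \<Rightarrow> 'a" where
  "monomial t j e = (\<lambda>(x, y). x ^ j * (\<Prod>i\<in>{1..t}. y i ^ e i))"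

definition eval_space :: "nat \<Rightarrow> nat \<Rightarrow> int \<Rightarrow> ('a::field point \<Rightarrow> 'a) set" where
  "eval_space p t l =
     fun_vs.span {monomial t j e | j e. int j \<le> l \<and> (\<forall>i\<in>{1..t}. e i \<le> p - 2)}"

text \<open>Words of length $n$ are functions on the naturals that vanish outside $\{1,\dots,n\}$,
  so that the pointwise operations on functions are those of the $n$-dimensional space.\<close>

definition words :: "nat \<Rightarrow> (nat \<Rightarrow> 'a::zero) set" where
  "words n = {w. \<forall>i. i \<notin> {1..n} \<longrightarrow> w i = 0}"

definition evaluation :: "nat \<Rightarrow> (nat \<Rightarrow> 'b) \<Rightarrow> ('b \<Rightarrow> 'a::zero) \<Rightarrow> nat \<Rightarrow> 'a" where
  "evaluation n Q f = (\<lambda>i. if i \<in> {1..n} then f (Q i) else 0)"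

definition linear_code :: "nat \<Rightarrow> (nat \<Rightarrow> 'a::field) set \<Rightarrow> bool" where
  "linear_code n C \<longleftrightarrow> C \<subseteq> words n \<and> fun_vs.subspace C"

definition hamming_dist :: "nat \<Rightarrow> (nat \<Rightarrow> 'a) \<Rightarrow> (nat \<Rightarrow> 'a) \<Rightarrow> nat" where
  "hamming_dist n u v = card {i \<in> {1..n}. u i \<noteq> v i}"

text \<open>For a code with at most one word this is the infimum of the empty set, which is $0$ in
  the naturals.\<close>

definition min_distance :: "nat \<Rightarrow> (nat \<Rightarrow> 'a) set \<Rightarrow> nat" where
  "min_distance n C = Inf {hamming_dist n u v | u v. u \<in> C \<and> v \<in> C \<and> u \<noteq> v}"

definition recovers :: "(nat \<Rightarrow> 'a) set \<Rightarrow> nat \<Rightarrow> nat set \<Rightarrow> bool" where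
  "recovers C i S \<longleftrightarrow> (\<exists>\<phi> :: (nat \<Rightarrow> 'a) \<Rightarrow> 'a. \<forall>c\<in>C. c i = \<phi> (restrict c S))"

definition recovery_system ::
    "nat \<Rightarrow> (nat \<Rightarrow> 'a) set \<Rightarrow> nat \<Rightarrow> (nat \<Rightarrow> nat) \<Rightarrow> (nat \<Rightarrow> nat \<Rightarrow> nat set) \<Rightarrow> bool" where
  "recovery_system n C t r R \<longleftrightarrow>
     (\<forall>i\<in>{1..n}. disjoint_family_on (R i) {1..t} \<and>
        (\<forall>j\<in>{1..t}. R i j \<subseteq> {1..n} - {i} \<and> card (R i j) = r j \<and> recovers C i (R i j)))"

definition has_availability_locality ::
    "nat \<Rightarrow> (nat \<Rightarrow> 'a) set \<Rightarrow> nat \<Rightarrow> (nat \<Rightarrow> nat) \<Rightarrow> bool" where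
  "has_availability_locality n C t r \<longleftrightarrow> (\<exists>R. recovery_system n C t r R)"

definition fiber_recovery_set ::
    "nat \<Rightarrow> nat \<Rightarrow> (nat \<Rightarrow> 'a point) \<Rightarrow> nat \<Rightarrow> nat \<Rightarrow> nat set" where
  "fiber_recovery_set n t Q i j =
     {m \<in> {1..n} - {i}. fst (Q m) = fst (Q i) \<and>
        (\<forall>k \<in> {1..t} - {j}. snd (Q m) k = snd (Q i) k)}"

end

theory Submission
  imports "HOL-Algebra.Algebraic_Closure_Type" Defs
begin

text \<open>
  Put \<open>m = p\<^sup>h + 1\<close>, let \<open>K\<close> be the algebraic closure of the rational function field and choose a
  generic point \<open>(x, Y\<^sub>1, \<dots>, Y\<^sub>t)\<close> of the curve over \<open>K\<close>.  Since the \<open>a\<^sub>i\<close> are independent over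
  the prime field, the monomials \<open>x\<^sup>j Y\<^sup>e\<close> with all \<open>e\<^sub>i < p\<close> are linearly independent.  Weigh \<open>x\<close>
  by \<open>p\<close> and each \<open>y\<^sub>i\<close> by \<open>m\<close>, and let \<open>L D\<close> be the functions on the curve of weight at most \<open>D\<close>.
  Then \<open>L D \<cdot> L D' \<subseteq> L (D + D')\<close>, and the dimension grows by at most \<open>p\<^bsup>t-1\<^esup>\<close> when \<open>D\<close> grows by one.
  If a nonzero \<open>F\<close> of weight \<open>w\<close> vanishes at the rational points in \<open>Z\<close>, then \<open>F \<cdot> L D\<close> together with
  interpolants of all functions on \<open>Z\<close> fits into \<open>L (D + w)\<close>; hence \<open>|Z| \<le> p\<^bsup>t-1\<^esup> w\<close>, which replaces
  the divisor-degree bound.  Dimension and distance follow.  Every \<open>x\<close> has \<open>p\<^sup>t\<close> points above it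
  because \<open>a\<^sub>i x\<^sup>m\<close> has trace zero, and recovery is interpolation of a polynomial of degree at most
  \<open>p - 2\<close> in \<open>y\<^sub>j\<close>.
\<close>

section \<open>Independence of monomials at a generic point\<close>

text \<open>The \<open>p\<close> multiples of 1 are fixed, by induction with the freshman's dream,
  and \<open>z^p - z\<close> has no more than \<open>p\<close> roots.\<close>

lemma frobenius_fixed_points:
  assumes "prime p" and "CHAR('k::field) = p"
  shows "{z :: 'k. z ^ p = z} = of_nat ` {..<p}" and "card {z :: 'k. z ^ p = z} = p"
proof -
  have p2: "p \<ge> 2" using assms(1) by (rule prime_ge_2_nat)
  define P :: "'k poly" where "P = monom 1 p - monom 1 1"
  have dp: "degree P = p"
    using degree_add_eq_left[of "- monom 1 1" "monom (1::'k) p"] p2 by (simp add: P_def degree_monom_eq)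
  hence P0: "P \<noteq> 0" using p2 by auto
  have eq: "{z :: 'k. z ^ p = z} = {z. poly P z = 0}" by (auto simp: P_def poly_monom)
  have fin: "finite {z :: 'k. z ^ p = z}" unfolding eq using P0 by (rule poly_roots_finite)
  have fr: "(of_nat n :: 'k) ^ p = of_nat n" for n
  proof (induction n)
    case 0 thus ?case using p2 by simp
  next
    case (Suc n)
    have "(1 + of_nat n :: 'k) ^ p = 1 ^ p + of_nat n ^ p"
      by (rule freshmans_dream) (use assms in auto)
    thus ?case using Suc by simp
  qed
  have sub: "of_nat ` {..<p} \<subseteq> {z :: 'k. z ^ p = z}" using fr by auto
  have "inj_on (of_nat :: nat \<Rightarrow> 'k) {..<p}"
  proof (rule linorder_inj_onI)
    fix x y assume "x < y" "x \<in> {..<p}" "y \<in> {..<p}"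
    hence "\<not> p dvd y - x" by (auto dest: dvd_imp_le)
    thus "(of_nat x :: 'k) \<noteq> of_nat y"
      using of_nat_eq_iff_char_dvd[OF \<open>x < y\<close>, where 'a = 'k] assms(2) by simp
  qed auto
  hence c: "card ((of_nat :: nat \<Rightarrow> 'k) ` {..<p}) = p" by (simp add: card_image)
  hence "card {z :: 'k. z ^ p = z} \<le> card ((of_nat :: nat \<Rightarrow> 'k) ` {..<p})"
    unfolding eq using card_poly_roots_bound[OF P0] dp by simp
  from card_seteq[OF fin sub this] c
  show "{z :: 'k. z ^ p = z} = of_nat ` {..<p}" "card {z :: 'k. z ^ p = z} = p" by simp_all
qed

text \<open>With \<open>w = Q/A\<close> the excluded equation reads \<open>w = w^p + c x^m\<close>.
  If \<open>Q\<close> has larger degree than \<open>A\<close>, then \<open>Q^p\<close> dominates and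
  \<open>m\<close> would be a multiple of \<open>p\<close>; otherwise \<open>A^p c x^m\<close> has
  strictly the largest degree.\<close>

lemma artin_schreier_no_fraction:
  fixes Q A :: "'a::field poly"
  assumes "\<not> p dvd m" and "A \<noteq> 0" and "c \<noteq> 0" and "p > 0"
  shows "A ^ (p - 1) * Q \<noteq> Q ^ p + A ^ p * monom c m"
proof
  assume eq: "A ^ (p - 1) * Q = Q ^ p + A ^ p * monom c m"
  have m0: "m > 0" using assms(1) by (cases m) auto
  have R: "degree (A ^ p * monom c m) = p * degree A + m"
    using assms by (simp add: degree_mult_eq degree_power_eq degree_monom_eq)
  have eq': "A ^ p * monom c m = A ^ (p - 1) * Q - Q ^ p" using eq by simp
  have l1: "degree (A ^ (p - 1) * Q) \<le> (p - 1) * degree A + degree Q"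
    using assms(2) by (metis degree_mult_le degree_power_eq)
  have pe: "p * n = (p - 1) * n + n" for n :: nat using assms(4) by (cases p) auto
  have Q': "degree (Q ^ p) = p * degree Q"
    by (cases "Q = 0") (use assms(4) in \<open>auto simp: degree_power_eq power_0_left\<close>)
  show False
  proof (cases "degree A < degree Q")
    case True
    show False
    proof (cases "p = 1")
      case True thus False using assms(1) by simp
    next
      case False
      hence "(p - 1) * degree A < (p - 1) * degree Q" using True assms(4) by simp
      hence "degree (A ^ (p - 1) * Q) < degree (Q ^ p)" using l1 Q' pe[of "degree Q"] by linarith
      hence "degree (A ^ (p - 1) * Q - Q ^ p) = p * degree Q"
        using degree_add_eq_right[of "A ^ (p - 1) * Q" "- (Q ^ p)"] Q' by simp
      hence "p * degree A + m = p * degree Q" using R eq' by simp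
      thus False using assms(1) by (metis dvd_add_right_iff dvd_triv_left)
    qed
  next
    case False
    hence "degree (A ^ (p - 1) * Q) \<le> p * degree A" "degree (Q ^ p) \<le> p * degree A"
      using l1 Q' pe[of "degree A"] mult_le_mono2[of "degree Q" "degree A" p] by auto
    hence "degree (A ^ (p - 1) * Q - Q ^ p) \<le> p * degree A" by (rule degree_diff_le)
    thus False using R eq' m0 by simp
  qed
qed

text \<open>An abstract generic point: \<open>\<phi>\<close> embeds the polynomials in
  \<open>x\<close> into a field that contains roots \<open>Y i\<close> of the curve equations.
  \<open>indep\<close> is independence over the prime field, with scalars written as images of
  natural numbers.\<close>

locale artin_schreier_point =
  fixes p m t :: nat and a :: "nat \<Rightarrow> 'a::field"
    and \<phi> :: "'a poly \<Rightarrow> 'k::field" and Y :: "nat \<Rightarrow> 'k"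
  assumes prime_p: "prime p" and CHAR_p: "CHAR('a) = p" and m_ndvd: "\<not> p dvd m"
    and phi_add: "\<phi> (P + R) = \<phi> P + \<phi> R"
    and phi_mult: "\<phi> (P * R) = \<phi> P * \<phi> R"
    and phi_1: "\<phi> 1 = 1"
    and phi_inj: "\<phi> P = 0 \<Longrightarrow> P = 0"
    and indep: "(\<Sum>i=1..t. of_nat (c i) * a i) = 0 \<Longrightarrow> i \<in> {1..t} \<Longrightarrow> (of_nat (c i) :: 'a) = 0"
    and Y_eq: "i \<in> {1..t} \<Longrightarrow> Y i ^ p = Y i + \<phi> (monom (a i) m)"
begin

lemma p2: "p \<ge> 2" using prime_p by (rule prime_ge_2_nat)

lemma phi_0 [simp]: "\<phi> 0 = 0" using phi_add[of 0 0] by (metis add_0 add_cancel_right_right)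

lemma phi_uminus: "\<phi> (- P) = - \<phi> P" using phi_add[of "-P" P] by (simp add: eq_neg_iff_add_eq_0)

lemma phi_diff: "\<phi> (P - R) = \<phi> P - \<phi> R"
  using phi_add[of P "-R"] by (simp add: phi_uminus)

lemma phi_power: "\<phi> (P ^ n) = \<phi> P ^ n" by (induction n) (auto simp: phi_1 phi_mult)

lemma phi_sum: "\<phi> (sum f A) = (\<Sum>x\<in>A. \<phi> (f x))"
  by (induction A rule: infinite_finite_induct) (auto simp: phi_add)

lemma phi_prod: "\<phi> (prod f A) = (\<Prod>x\<in>A. \<phi> (f x))"
  by (induction A rule: infinite_finite_induct) (auto simp: phi_mult phi_1)

lemma phi_of_nat: "\<phi> (of_nat n) = of_nat n"
  by (induction n) (auto simp: phi_add phi_1)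

lemma CHAR_k: "CHAR('k) = p"
proof (rule CHAR_eqI)
  have "(of_nat p :: 'a poly) = 0" using CHAR_p by (simp add: of_nat_eq_0_iff_char_dvd)
  thus "(of_nat p :: 'k) = 0" by (metis phi_0 phi_of_nat)
next
  fix x assume "(of_nat x :: 'k) = 0"
  hence "(of_nat x :: 'a poly) = 0" using phi_of_nat phi_inj by metis
  thus "p dvd x" using CHAR_p by (simp add: of_nat_eq_0_iff_char_dvd)
qed

definition Ymon :: "(nat \<Rightarrow> nat) \<Rightarrow> 'k" where
  "Ymon e = (\<Prod>i=1..t. Y i ^ e i)"

text \<open>Each \<open>(Y i ^ p) ^ e i\<close> is a power of \<open>Y i + a i x^m\<close> and
  expands binomially. Only exponents componentwise at most \<open>e\<close> occur, so Frobenius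
  preserves combinations over a downward closed set.\<close>

lemma Ymon_frobenius:
  "Ymon e ^ p = (\<Sum>e'\<in>PiE {1..t} (\<lambda>i. {..e i}).
     \<phi> (\<Prod>i=1..t. of_nat (e i choose e' i) * monom (a i) m ^ (e i - e' i)) * Ymon e')"
proof -
  have "Ymon e ^ p = (\<Prod>i=1..t. (Y i ^ p) ^ e i)"
    by (simp add: Ymon_def mult.commute flip: power_mult prod_power_distrib[symmetric])
  also have "\<dots> = (\<Prod>i=1..t. \<Sum>k\<le>e i. of_nat (e i choose k) * Y i ^ k * \<phi> (monom (a i) m) ^ (e i - k))"
    by (intro prod.cong refl) (simp add: Y_eq binomial_ring)
  also have "\<dots> = (\<Sum>e'\<in>PiE {1..t} (\<lambda>i. {..e i}). \<Prod>i=1..t.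
       of_nat (e i choose e' i) * Y i ^ e' i * \<phi> (monom (a i) m) ^ (e i - e' i))"
    by (rule prod_sum_PiE) auto
  also have "\<dots> = (\<Sum>e'\<in>PiE {1..t} (\<lambda>i. {..e i}).
     \<phi> (\<Prod>i=1..t. of_nat (e i choose e' i) * monom (a i) m ^ (e i - e' i)) * Ymon e')"
    by (intro sum.cong refl)
       (simp add: Ymon_def phi_prod phi_mult phi_of_nat phi_power mult_ac flip: prod.distrib)
  finally show ?thesis .
qed

text \<open>A relation, rescaled by a power of the coefficient \<open>A\<close> of a monomial of maximal degree, minus
  its Frobenius image is a shorter relation, hence trivial.  Its top coefficients are then
  \<open>F\<^sub>p\<close>-multiples of \<open>A\<close>, and the coefficient one degree below the top would solve an
  Artin--Schreier equation over the rational functions, which is impossible by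
  degree.\<close>

theorem Ymon_independent:
  assumes "finite S" and "S \<subseteq> PiE {1..t} (\<lambda>_. {..<p})"
    and "\<And>e. e \<in> S \<Longrightarrow> PiE {1..t} (\<lambda>i. {..e i}) \<subseteq> S"
    and "(\<Sum>e\<in>S. \<phi> (P e) * Ymon e) = 0"
    and "e \<in> S"
  shows "P e = 0"
  using assms
proof (induction "card S" arbitrary: S P e rule: less_induct)
  case less
  note finS = less.prems(1) and SE = less.prems(2) and down = less.prems(3) and rel = less.prems(4)
  let ?T = "{1..t}"
  define deg :: "(nat \<Rightarrow> nat) \<Rightarrow> nat" where "deg e = (\<Sum>i\<in>?T. e i)" for e
  have "Max (deg ` S) \<in> deg ` S" using less.prems by (intro Max_in) auto
  then obtain e0 where e0: "e0 \<in> S" "deg e0 = Max (deg ` S)" by auto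
  have max: "deg e \<le> deg e0" if "e \<in> S" for e using that finS e0(2) by simp
  have eqI: "e1 = e2"
    if "e1 \<in> S" "e2 \<in> S" "\<And>i. i \<in> ?T \<Longrightarrow> e1 i \<le> e2 i" "deg e2 \<le> deg e1" for e1 e2
  proof (rule ccontr)
    assume "e1 \<noteq> e2"
    then obtain i where i: "i \<in> ?T" "e1 i \<noteq> e2 i"
      using PiE_ext[of e1 ?T "\<lambda>_. {..<p}" e2] \<open>e1 \<in> S\<close> \<open>e2 \<in> S\<close> SE by blast
    have "deg e1 < deg e2" unfolding deg_def
      by (rule sum_strict_mono_ex1) (use i that(3) in \<open>auto intro!: bexI[of _ i] le_neq_implies_less\<close>)
    thus False using that by simp
  qed
  define S' where "S' = S - {e0}"
  have IH: "R e = 0" if "(\<Sum>e\<in>S'. \<phi> (R e) * Ymon e) = 0" "e \<in> S'" for R e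
  proof (rule less.hyps[of S' R e])
    show "card S' < card S" unfolding S'_def using e0(1) finS by (meson card_Diff1_less)
    show "finite S'" "S' \<subseteq> PiE ?T (\<lambda>_. {..<p})" using finS SE by (auto simp: S'_def)
    show "(\<Sum>e\<in>S'. \<phi> (R e) * Ymon e) = 0" "e \<in> S'" using that by auto
    fix e1 assume e1: "e1 \<in> S'"
    \<comment> \<open>Removing an exponent of maximal degree keeps the set downward closed.\<close>
    have "e0 \<notin> PiE ?T (\<lambda>i. {..e1 i})"
    proof
      assume "e0 \<in> PiE ?T (\<lambda>i. {..e1 i})"
      hence "e0 = e1" using e0(1) e1 max[of e1] by (intro eqI) (auto simp: S'_def)
      thus False using e1 by (simp add: S'_def)
    qed
    thus "PiE ?T (\<lambda>i. {..e1 i}) \<subseteq> S'" using down[of e1] e1 by (auto simp: S'_def)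
  qed
  have split: "(\<Sum>e\<in>S. \<phi> (R e) * Ymon e) = \<phi> (R e0) * Ymon e0 + (\<Sum>e\<in>S'. \<phi> (R e) * Ymon e)" for R
    unfolding S'_def using e0(1) finS by (rule sum.remove[rotated])
  define A where "A = P e0"
  have A0: "A = 0"
  proof (rule ccontr)
    assume A: "A \<noteq> 0"
    define F :: "(nat \<Rightarrow> nat) \<Rightarrow> (nat \<Rightarrow> nat) \<Rightarrow> 'a poly" where
      "F e e' = (\<Prod>i\<in>?T. of_nat (e i choose e' i) * monom (a i) m ^ (e i - e' i))" for e e'
    define above where "above e' = {e\<in>S. \<forall>i\<in>?T. e' i \<le> e i}" for e'
    \<comment> \<open>The coefficient of \<open>Ymon e'\<close> in the \<open>p\<close>-th power of
      the relation.\<close>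
    define G where "G e' = (\<Sum>e\<in>above e'. P e ^ p * F e e')" for e'
    have Fself: "F e e = 1" for e by (simp add: F_def)
    have frob: "(\<Sum>e\<in>S. \<phi> (G e) * Ymon e) = 0"
    proof -
      have "0 = (\<Sum>e\<in>S. \<phi> (P e) * Ymon e) ^ p" using rel p2 by simp
      also have "\<dots> = (\<Sum>e\<in>S. (\<phi> (P e) * Ymon e) ^ p)"
        by (rule freshmans_dream_sum) (auto simp: CHAR_k prime_p)
      also have "\<dots> = (\<Sum>e\<in>S. \<Sum>e'\<in>PiE ?T (\<lambda>i. {..e i}). \<phi> (P e ^ p * F e e') * Ymon e')"
        by (simp add: power_mult_distrib Ymon_frobenius F_def phi_mult phi_power sum_distrib_left mult_ac)
      also have "\<dots> = (\<Sum>e\<in>S. \<Sum>e'\<in>{e'\<in>S. \<forall>i\<in>?T. e' i \<le> e i}. \<phi> (P e ^ p * F e e') * Ymon e')"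
      proof (intro sum.cong refl)
        fix e assume "e \<in> S"
        show "PiE ?T (\<lambda>i. {..e i}) = {e'\<in>S. \<forall>i\<in>?T. e' i \<le> e i}"
        proof (intro subset_antisym subsetI)
          fix e' assume "e' \<in> {e'\<in>S. \<forall>i\<in>?T. e' i \<le> e i}"
          thus "e' \<in> PiE ?T (\<lambda>i. {..e i})" using SE by (auto simp: PiE_iff)
        qed (use down[OF \<open>e \<in> S\<close>] in auto)
      qed
      also have "\<dots> = (\<Sum>e'\<in>S. \<Sum>e\<in>above e'. \<phi> (P e ^ p * F e e') * Ymon e')"
        unfolding above_def by (rule sum.swap_restrict) (use finS in auto)
      also have "\<dots> = (\<Sum>e\<in>S. \<phi> (G e) * Ymon e)"
        by (simp add: G_def phi_sum sum_distrib_right)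
      finally show ?thesis by simp
    qed
    \<comment> \<open>No other exponent of \<open>S\<close> lies above one of maximal degree, so
      only the term with \<open>F e e = 1\<close> remains.\<close>
    have top: "G e = P e ^ p" if "e \<in> S" "deg e = deg e0" for e
    proof -
      have "e1 = e" if "e1 \<in> above e" for e1 :: "nat \<Rightarrow> nat"
        by (rule sym, rule eqI) (use that \<open>e \<in> S\<close> \<open>deg e = deg e0\<close> max in \<open>auto simp: above_def\<close>)
      hence "above e = {e}" using that(1) by (auto simp: above_def)
      thus ?thesis by (simp add: G_def Fself)
    qed
    have pS: "A ^ (p - 1) * A = A ^ p" using p2 by (intro power_minus_mult) simp
    \<comment> \<open>The factor \<open>A^(p-1)\<close> makes both coefficients at \<open>e0\<close>
      equal to \<open>A^p\<close>, so the difference is a relation over \<open>S'\<close> and the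
      induction hypothesis applies.\<close>
    have "(\<Sum>e\<in>S. \<phi> (A ^ (p - 1) * P e - G e) * Ymon e)
        = \<phi> (A ^ (p - 1)) * (\<Sum>e\<in>S. \<phi> (P e) * Ymon e) - (\<Sum>e\<in>S. \<phi> (G e) * Ymon e)"
      by (simp add: phi_diff phi_mult sum_subtractf sum_distrib_left algebra_simps)
    also have "\<dots> = 0" using rel frob by simp
    finally have "(\<Sum>e\<in>S'. \<phi> (A ^ (p - 1) * P e - G e) * Ymon e) = 0"
      using split[of "\<lambda>e. A ^ (p - 1) * P e - G e"] top[OF e0(1)] pS
      by (simp add: A_def[symmetric])
    hence GP: "A ^ (p - 1) * P e = G e" if "e \<in> S'" for e
      using IH[of "\<lambda>e. A ^ (p - 1) * P e - G e" e] that by simp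
    \<comment> \<open>Dividing by \<open>A^p\<close> shows that \<open>P e / A\<close> is fixed by
      Frobenius, hence lies in the prime field.\<close>
    have scal: "\<exists>c::nat. P e = of_nat c * A" if "e \<in> S" "deg e = deg e0" for e
    proof (cases "e = e0")
      case True thus ?thesis by (intro exI[of _ 1]) (simp add: A_def)
    next
      case False
      hence "A ^ (p - 1) * P e = P e ^ p" using GP top that by (simp add: S'_def)
      hence *: "\<phi> A ^ (p - 1) * \<phi> (P e) = \<phi> (P e) ^ p" by (metis phi_mult phi_power)
      have fA: "\<phi> A \<noteq> 0" using A phi_inj by blast
      have "\<phi> A ^ p = \<phi> A ^ (p - 1) * \<phi> A" using pS by (metis phi_mult phi_power)
      hence "(\<phi> (P e) / \<phi> A) ^ p = \<phi> (P e) / \<phi> A"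
        using * fA by (simp add: power_divide field_simps)
      then obtain c where "\<phi> (P e) / \<phi> A = of_nat c"
        using frobenius_fixed_points(1)[OF prime_p CHAR_k] by blast
      hence "\<phi> (P e - of_nat c * A) = 0"
        using fA by (simp add: field_simps phi_diff phi_mult phi_of_nat)
      thus ?thesis using phi_inj by (metis eq_iff_diff_eq_0)
    qed
    have "\<exists>i\<in>?T. e0 i > 0"
    proof (rule ccontr)
      assume "\<not> (\<exists>i\<in>?T. e0 i > 0)"
      hence z: "\<And>i. i \<in> ?T \<Longrightarrow> e0 i = 0" by auto
      have "e = e0" if "e \<in> S" for e
        using max[OF that] that e0(1) z by (intro sym[OF eqI]) auto
      hence "S' = {}" unfolding S'_def by blast
      hence "\<phi> A = 0" using split[of P] rel z by (simp add: A_def Ymon_def)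
      thus False using A phi_inj by blast
    qed
    then obtain i0 where i0: "i0 \<in> ?T" "e0 i0 > 0" by auto
    \<comment> \<open>\<open>e'\<close> lies one degree below the top, and the \<open>up k\<close>
      are its possible neighbours of top degree; \<open>up i0\<close> is \<open>e0\<close>.\<close>
    define e' where "e' = e0(i0 := e0 i0 - 1)"
    define up where "up k = e'(k := Suc (e' k))" for k
    have upi0: "up i0 = e0" using i0 by (auto simp: up_def e'_def fun_eq_iff)
    have e'S: "e' \<in> S"
      using down[OF e0(1)] e0(1) SE i0 by (force simp: e'_def PiE_iff extensional_def)
    have degup: "deg (up k) = Suc (deg e')" if "k \<in> ?T" for k
    proof -
      have "deg (up k) = up k k + (\<Sum>i\<in>?T-{k}. up k i)" "deg e' = e' k + (\<Sum>i\<in>?T-{k}. e' i)"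
        unfolding deg_def using that by (auto intro!: sum.remove)
      moreover have "(\<Sum>i\<in>?T-{k}. up k i) = (\<Sum>i\<in>?T-{k}. e' i)"
        by (intro sum.cong) (auto simp: up_def)
      ultimately show ?thesis by (simp add: up_def)
    qed
    have dege0: "deg e0 = Suc (deg e')" using degup[OF i0(1)] upi0 by simp
    have e'S': "e' \<in> S'" using e'S dege0 by (auto simp: S'_def)
    define K where "K = {k\<in>?T. up k \<in> S}"
    \<comment> \<open>Degrees in \<open>S\<close> exceed that of \<open>e'\<close> by at most one,
      so anything strictly above \<open>e'\<close> is a unit increment.\<close>
    have above': "above e' = insert e' (up ` K)"
    proof (intro subset_antisym subsetI)
      fix e assume "e \<in> above e'"
      hence e: "e \<in> S" "\<And>i. i \<in> ?T \<Longrightarrow> e' i \<le> e i" by (auto simp: above_def)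
      show "e \<in> insert e' (up ` K)"
      proof (cases "e = e'")
        case False
        have "\<exists>k\<in>?T. e' k < e k"
        proof (rule ccontr)
          assume "\<not> ?thesis"
          hence "\<And>i. i \<in> ?T \<Longrightarrow> e i = e' i" using e(2) by (meson le_antisym not_le)
          hence "e = e'" using e(1) e'S SE by (intro PiE_ext[of e ?T "\<lambda>_. {..<p}" e']) auto
          thus False using False by simp
        qed
        then obtain k where k: "k \<in> ?T" "e' k < e k" by auto
        have le: "up k i \<le> e i" if "i \<in> ?T" for i using e(2)[OF that] k by (auto simp: up_def)
        have "up k \<in> PiE ?T (\<lambda>i. {..e i})"
          using le e'S SE k(1) by (force simp: PiE_iff extensional_def up_def)
        hence upS: "up k \<in> S" using down[OF e(1)] by auto
        hence "up k = e" using e le max[OF e(1)] degup[OF k(1)] dege0 by (intro eqI) auto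
        thus ?thesis using upS k by (auto simp: K_def)
      qed simp
    qed (use e'S in \<open>auto simp: above_def K_def up_def\<close>)
    have notin: "e' \<notin> up ` K"
    proof
      assume "e' \<in> up ` K"
      then obtain k where "e' = up k" by blast
      from fun_cong[OF this, of k] show False by (simp add: up_def)
    qed
    have injup: "inj_on up K" 
    proof (rule inj_onI, rule ccontr)
      fix k l assume "up k = up l" "k \<noteq> l"
      from fun_cong[OF this(1), of k] this(2) show False by (simp add: up_def)
    qed
    have finK: "finite K" by (simp add: K_def)
    have Fup: "F (up k) e' = smult (of_nat (Suc (e' k))) (monom (a k) m)" if "k \<in> ?T" for k
    proof -
      have "F (up k) e' = (of_nat (up k k choose e' k) * monom (a k) m ^ (up k k - e' k))
         * (\<Prod>i\<in>?T-{k}. of_nat (up k i choose e' i) * monom (a i) m ^ (up k i - e' i))"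
        unfolding F_def using that by (intro prod.remove) auto
      also have "(\<Prod>i\<in>?T-{k}. of_nat (up k i choose e' i) * monom (a i) m ^ (up k i - e' i)) = 1"
        by (intro prod.neutral) (auto simp: up_def)
      also have "of_nat (up k k choose e' k) * monom (a k) m ^ (up k k - e' k) * 1
          = smult (of_nat (Suc (e' k))) (monom (a k) m)"
        by (simp add: up_def of_nat_poly del: of_nat_Suc)
      finally show ?thesis .
    qed
    have "\<forall>k\<in>K. \<exists>c::nat. P (up k) = of_nat c * A"
      using scal degup dege0 by (auto simp: K_def)
    then obtain c :: "nat \<Rightarrow> nat" where c: "\<And>k. k \<in> K \<Longrightarrow> P (up k) = of_nat (c k) * A" by metis
    \<comment> \<open>After division by \<open>A^p\<close>, the neighbour \<open>up k\<close>
      contributes \<open>b k * a k * x^m\<close> to \<open>G e'\<close>. Extension by zero off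
      \<open>K\<close> lets \<open>indep\<close> be used on all of \<open>{1..t}\<close>.\<close>
    define b where "b k = (if k \<in> K then (c k) ^ p * Suc (e' k) else 0)" for k
    define lam where "lam = (\<Sum>k=1..t. of_nat (b k) * a k)"
    have "G e' = P e' ^ p + (\<Sum>k\<in>K. P (up k) ^ p * F (up k) e')"
      unfolding G_def above' using notin finK by (simp add: sum.reindex[OF injup] Fself)
    also have "(\<Sum>k\<in>K. P (up k) ^ p * F (up k) e') = (\<Sum>k\<in>K. A ^ p * monom (of_nat (b k) * a k) m)"
    proof (intro sum.cong refl)
      fix k assume k: "k \<in> K"
      hence "k \<in> ?T" by (simp add: K_def)
      have "P (up k) ^ p * F (up k) e' = A ^ p * (of_nat (c k) ^ p * F (up k) e')"
        using c[OF k] by (simp add: power_mult_distrib mult_ac)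
      also have "of_nat (c k) ^ p * F (up k) e' = of_nat (c k ^ p) * F (up k) e'" by simp
      also have "\<dots> = smult (of_nat (c k ^ p) * of_nat (Suc (e' k))) (monom (a k) m)"
        unfolding Fup[OF \<open>k \<in> ?T\<close>] of_nat_poly by (simp add: mult.commute)
      also have "\<dots> = monom (of_nat (b k) * a k) m"
        using k by (simp only: b_def if_True of_nat_mult smult_monom)
      finally show "P (up k) ^ p * F (up k) e' = A ^ p * monom (of_nat (b k) * a k) m" .
    qed
    also have "\<dots> = (\<Sum>k\<in>?T. A ^ p * monom (of_nat (b k) * a k) m)"
      by (intro sum.mono_neutral_left) (auto simp: K_def b_def)
    also have "\<dots> = A ^ p * monom lam m"
      by (simp add: lam_def monom_sum sum_distrib_left)
    finally have "A ^ (p - 1) * P e' = P e' ^ p + A ^ p * monom lam m"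
      using GP[OF e'S'] by simp
    \<comment> \<open>By independence it is enough that \<open>p\<close> does not divide
      \<open>b i0\<close>: \<open>c i0\<close> is nonzero modulo \<open>p\<close> because
      \<open>P e0 = A\<close>, and the other factor is \<open>e0 i0\<close>, strictly between 0 and
      \<open>p\<close>.\<close>
    moreover have "lam \<noteq> 0"
    proof
      assume "lam = 0"
      hence "(of_nat (b i0) :: 'a) = 0" using indep[of b i0] i0(1) by (simp add: lam_def)
      hence "p dvd b i0" using CHAR_p of_nat_eq_0_iff_char_dvd by metis
      moreover have i0K: "i0 \<in> K" using i0 upi0 e0 by (simp add: K_def)
      ultimately have "p dvd c i0 \<or> p dvd Suc (e' i0)"
        using prime_p by (auto simp: b_def prime_dvd_mult_iff prime_dvd_power_iff dest: prime_dvd_power simp del: mult_Suc_right)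
      moreover have "\<not> p dvd Suc (e' i0)"
      proof -
        have "Suc (e' i0) = e0 i0" using i0 by (simp add: e'_def)
        moreover have "e0 i0 < p" using e0(1) SE i0(1) by (auto simp: PiE_iff)
        ultimately show ?thesis using i0(2) by (auto dest: dvd_imp_le)
      qed
      moreover have "\<not> p dvd c i0"
      proof
        assume "p dvd c i0"
        hence "(of_nat (c i0) :: 'a poly) = 0" using CHAR_p by (simp add: of_nat_eq_0_iff_char_dvd)
        thus False using c[OF i0K] upi0 A by (simp add: A_def)
      qed
      ultimately show False by blast
    qed
    ultimately show False
      using artin_schreier_no_fraction[OF m_ndvd A, of lam "P e'"] p2 by auto
  qed
  hence "(\<Sum>e\<in>S'. \<phi> (P e) * Ymon e) = 0" using split[of P] rel by (simp add: A_def)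
  hence "\<And>e. e \<in> S' \<Longrightarrow> P e = 0" using IH[of P] by blast
  thus "P e = 0" using A0 less.prems(5) by (cases "e = e0") (auto simp: A_def S'_def)
qed

end

section \<open>Counting zeros\<close>

text \<open>Multiplication by \<open>x\<close> permutes the nonzero elements, so their product
  absorbs the factor \<open>x^(q-1)\<close>. Finiteness is a hypothesis rather than a sort because
  the locale fixes only a field type.\<close>

lemma finite_field_power_card_minus_1:
  assumes "finite (UNIV :: 'a::field set)" and "x \<noteq> (0 :: 'a)"
  shows "x ^ (CARD('a) - 1) = 1"
proof -
  have "(\<Prod>y\<in>UNIV-{0}. y) = (\<Prod>y\<in>UNIV-{0}. x * y)"
    by (rule prod.reindex_bij_witness[of _ "\<lambda>y. x * y" "\<lambda>y. y / x"]) (use assms(2) in auto)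
  also have "\<dots> = x ^ (CARD('a) - 1) * (\<Prod>y\<in>UNIV-{0}. y)"
    by (simp add: prod.distrib card_Diff_singleton)
  finally show ?thesis using assms(1) by simp
qed

lemma finite_field_power_card:
  fixes x :: "'a::{field,finite}"
  shows "x ^ CARD('a) = x"
proof (cases "x = 0")
  case False
  have "x ^ CARD('a) = x ^ (CARD('a) - 1) * x" by (rule power_minus_mult[symmetric]) simp
  thus ?thesis using finite_field_power_card_minus_1[of x] False by simp
qed simp

section \<open>Functions of bounded weight on the curve\<close>

context artin_schreier_point
begin

abbreviation \<kappa> :: "'a \<Rightarrow> 'k" where "\<kappa> c \<equiv> \<phi> [:c:]"

lemma kappa_add: "\<kappa> (c + d) = \<kappa> c + \<kappa> d" by (simp flip: phi_add)
lemma kappa_mult: "\<kappa> (c * d) = \<kappa> c * \<kappa> d" by (simp add: mult.commute flip: phi_mult)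
lemma kappa_diff: "\<kappa> (c - d) = \<kappa> c - \<kappa> d" by (simp flip: phi_diff)
lemma kappa_1: "\<kappa> 1 = 1" using phi_1 by (simp add: one_pCons)
lemma kappa_power: "\<kappa> (c ^ n) = \<kappa> c ^ n" by (induction n) (auto simp: kappa_mult kappa_1)
lemma kappa_sum: "\<kappa> (sum f A) = (\<Sum>x\<in>A. \<kappa> (f x))"
  by (induction A rule: infinite_finite_induct) (auto simp: kappa_add)
lemma kappa_prod: "\<kappa> (prod f A) = (\<Prod>x\<in>A. \<kappa> (f x))"
  by (induction A rule: infinite_finite_induct) (auto simp: kappa_mult kappa_1)
lemma kappa_eq_iff: "\<kappa> c = \<kappa> d \<longleftrightarrow> c = d"
proof
  assume "\<kappa> c = \<kappa> d"
  hence "\<kappa> (c - d) = 0" by (simp only: kappa_diff) simp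
  thus "c = d" using phi_inj by fastforce
qed simp

text \<open>Points over the large field: the generic point, where independence is read off, and the
  images of the rational points are among them. Coordinates outside \<open>{1..t}\<close> are
  free.\<close>

definition curve :: "'k point set" where
  "curve = {(x, y). \<forall>i\<in>{1..t}. y i ^ p - y i = \<kappa> (a i) * x ^ m}"

definition gx :: 'k where "gx = \<phi> (monom 1 1)"

lemma phi_monom: "\<phi> (monom c j) = \<kappa> c * gx ^ j"
proof -
  have "monom c j = [:c:] * monom 1 1 ^ j" by (simp add: monom_power smult_monom)
  thus ?thesis by (simp only: gx_def phi_mult phi_power)
qed

lemma generic_point_in_curve: "(gx, Y) \<in> curve"
  by (auto simp: curve_def Y_eq phi_monom)

text \<open>The weight is the pole order of \<open>x\<^sup>j y\<^sup>e\<close> at infinity, divided by \<open>p\<^bsup>t-1\<^esup>\<close>.\<close>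

definition weight :: "nat \<Rightarrow> (nat \<Rightarrow> nat) \<Rightarrow> nat" where
  "weight j e = p * j + m * (\<Sum>i=1..t. e i)"

definition idx :: "nat \<Rightarrow> (nat \<times> (nat \<Rightarrow> nat)) set" where
  "idx D = {(j, e). e \<in> {1..t} \<rightarrow>\<^sub>E {..<p} \<and> weight j e \<le> D}"

lemma finite_idx: "finite (idx D)"
proof (rule finite_subset)
  show "idx D \<subseteq> {..D} \<times> ({1..t} \<rightarrow>\<^sub>E {..<p})"
  proof
    fix u assume "u \<in> idx D"
    then obtain j e where u: "u = (j, e)" "e \<in> {1..t} \<rightarrow>\<^sub>E {..<p}" "weight j e \<le> D"
      by (auto simp: idx_def)
    have "j \<le> p * j" using p2 by (cases p) auto
    moreover have "p * j \<le> D" using u(3) by (simp add: weight_def)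
    ultimately have "j \<le> D" by linarith
    thus "u \<in> {..D} \<times> ({1..t} \<rightarrow>\<^sub>E {..<p})" using u by auto
  qed
qed (auto intro: finite_PiE)

definition lin_comb :: "(nat \<times> (nat \<Rightarrow> nat)) set \<Rightarrow> (nat \<times> (nat \<Rightarrow> nat) \<Rightarrow> 'a) \<Rightarrow> 'k point \<Rightarrow> 'k" where
  "lin_comb U c P = (\<Sum>u\<in>U. \<kappa> (c u) * monomial t (fst u) (snd u) P)"

text \<open>The analogue of a Riemann-Roch space at infinity. Coefficients stay in the base field,
  so over a finite field the space can be counted by coefficient tuples; membership concerns only
  values on the curve.\<close>

definition L :: "nat \<Rightarrow> ('k point \<Rightarrow> 'k) set" where
  "L D = {F. \<exists>c. \<forall>P\<in>curve. F P = lin_comb (idx D) c P}"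

lemma L_cong: "F \<in> L D \<Longrightarrow> (\<And>P. P \<in> curve \<Longrightarrow> G P = F P) \<Longrightarrow> G \<in> L D"
  by (auto simp: L_def)

lemma L_add:
  assumes "F \<in> L D" "G \<in> L D" shows "(\<lambda>P. F P + G P) \<in> L D"
proof -
  from assms obtain c d where "\<forall>P\<in>curve. F P = lin_comb (idx D) c P" "\<forall>P\<in>curve. G P = lin_comb (idx D) d P"
    by (auto simp: L_def)
  thus ?thesis unfolding L_def mem_Collect_eq
    by (intro exI[of _ "\<lambda>u. c u + d u"]) (simp add: lin_comb_def kappa_add sum.distrib algebra_simps)
qed

lemma L_scale:
  assumes "F \<in> L D" shows "(\<lambda>P. \<kappa> k * F P) \<in> L D"
proof -
  from assms obtain c where "\<forall>P\<in>curve. F P = lin_comb (idx D) c P" by (auto simp: L_def)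
  thus ?thesis unfolding L_def mem_Collect_eq
    by (intro exI[of _ "\<lambda>u. k * c u"]) (simp add: lin_comb_def kappa_mult sum_distrib_left algebra_simps)
qed

lemma L_0: "(\<lambda>P. 0) \<in> L D"
  unfolding L_def mem_Collect_eq by (intro exI[of _ "\<lambda>_. 0"]) (simp add: lin_comb_def)

lemma L_sum: "(\<And>x. x \<in> A \<Longrightarrow> F x \<in> L D) \<Longrightarrow> (\<lambda>P. \<Sum>x\<in>A. F x P) \<in> L D"
  by (induction A rule: infinite_finite_induct) (auto intro: L_0 L_add)

lemma L_diff:
  assumes "F \<in> L D" "G \<in> L D" shows "(\<lambda>P. F P - G P) \<in> L D"
proof -
  have "\<kappa> (-1) = -1" using kappa_diff[of 0 1] by (simp add: kappa_1)
  thus ?thesis using L_add[OF assms(1) L_scale[OF assms(2), of "-1"]] by simp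
qed

lemma L_mono:
  assumes "F \<in> L D" "D \<le> D'" shows "F \<in> L D'"
proof -
  from assms obtain c where c: "\<forall>P\<in>curve. F P = lin_comb (idx D) c P" by (auto simp: L_def)
  have sub: "idx D \<subseteq> idx D'" using assms(2) by (auto simp: idx_def)
  have "lin_comb (idx D) c P = lin_comb (idx D') (\<lambda>u. if u \<in> idx D then c u else 0) P" for P
    unfolding lin_comb_def by (rule sum.mono_neutral_cong_left) (use sub finite_idx in auto)
  thus ?thesis using c by (auto simp: L_def)
qed

lemma sum_fun_upd:
  assumes "i \<in> {1..t}" shows "(\<Sum>k=1..t. (e(i := n)) k) + e i = (\<Sum>k=1..t. e k) + (n::nat)"
proof -
  have "(\<Sum>k\<in>{1..t}-{i}. (e(i := n)) k) = (\<Sum>k\<in>{1..t}-{i}. e k)" by (intro sum.cong) auto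
  thus ?thesis using assms sum.remove[of "{1..t}" i e] sum.remove[of "{1..t}" i "e(i := n)"] by simp
qed

lemma monomial_fun_upd:
  assumes "i \<in> {1..t}"
  shows "monomial t j e (x, y) = x ^ j * (y i ^ e i * (\<Prod>k\<in>{1..t}-{i}. y k ^ e k))"
    and "monomial t j (e(i := n)) (x, y) = x ^ j * (y i ^ n * (\<Prod>k\<in>{1..t}-{i}. y k ^ e k))"
proof -
  have "(\<Prod>k\<in>{1..t}-{i}. y k ^ (e(i := n)) k) = (\<Prod>k\<in>{1..t}-{i}. y k ^ e k)"
    by (intro prod.cong) auto
  thus "monomial t j e (x, y) = x ^ j * (y i ^ e i * (\<Prod>k\<in>{1..t}-{i}. y k ^ e k))"
    "monomial t j (e(i := n)) (x, y) = x ^ j * (y i ^ n * (\<Prod>k\<in>{1..t}-{i}. y k ^ e k))"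
    using assms prod.remove[of "{1..t}" i "\<lambda>k. y k ^ e k"]
      prod.remove[of "{1..t}" i "\<lambda>k. y k ^ (e(i := n)) k"]
    by (simp_all add: monomial_def)
qed

text \<open>Rewriting \<open>y\<^sub>i\<^sup>p\<close> as \<open>y\<^sub>i + a\<^sub>i x\<^sup>m\<close> does not increase the weight.\<close>

lemma L_monomial: "weight j e \<le> D \<Longrightarrow> monomial t j e \<in> L D"
proof (induction "\<Sum>i=1..t. e i" arbitrary: j e rule: less_induct)
  case less
  show ?case
  proof (cases "\<forall>i\<in>{1..t}. e i < p")
    case True
    define e' where "e' = restrict e {1..t}"
    have "weight j e' = weight j e" by (simp add: weight_def e'_def)
    hence u: "(j, e') \<in> idx D" using True less.prems by (auto simp: idx_def e'_def)
    have "lin_comb (idx D) (\<lambda>u. if u = (j, e') then 1 else 0) P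
        = (\<Sum>u\<in>idx D. if u = (j, e') then monomial t j e' P else 0)" for P
      unfolding lin_comb_def by (intro sum.cong) (auto simp: kappa_1)
    also have "\<dots> P = monomial t j e P" for P
      using u finite_idx by (cases P) (simp add: monomial_def e'_def)
    finally have "\<And>P. monomial t j e P = lin_comb (idx D) (\<lambda>u. if u = (j, e') then 1 else 0) P" by simp
    thus ?thesis unfolding L_def by blast
  next
    case False
    then obtain i where i: "i \<in> {1..t}" "e i \<ge> p" by (auto simp: not_less)
    \<comment> \<open>The exponents of the two terms in
      \<open>y_i^(e_i - p) * (y_i + a_i x^m)\<close>.\<close>
    define e1 where "e1 = e(i := e i - p + 1)"
    define e2 where "e2 = e(i := e i - p)"
    let ?s = "\<lambda>e. \<Sum>i=1..t. e i"
    have s1: "?s e1 + p = ?s e + 1" and s2: "?s e2 + p = ?s e"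
      using sum_fun_upd[OF i(1), of e "e i - p + 1"] sum_fun_upd[OF i(1), of e "e i - p"] i(2)
      by (simp_all add: e1_def e2_def)
    \<comment> \<open>\<open>p\<close> factors \<open>y_i\<close> of weight \<open>m\<close> are
      traded for \<open>m\<close> factors \<open>x\<close> of weight \<open>p\<close>.\<close>
    have "m * ?s e = m * ?s e2 + m * p" using s2 by (metis distrib_left)
    hence "weight (j + m) e2 \<le> D" using less.prems by (simp add: weight_def algebra_simps)
    hence L2: "monomial t (j + m) e2 \<in> L D" using s2 p2 by (intro less.hyps) auto
    have "m * ?s e1 \<le> m * ?s e" using s1 p2 by (intro mult_left_mono) auto
    hence "weight j e1 \<le> D" using less.prems unfolding weight_def by linarith
    hence L1: "monomial t j e1 \<in> L D" using s1 p2 by (intro less.hyps) auto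
    show ?thesis
    proof (rule L_cong[OF L_add[OF L1 L_scale[OF L2, of "a i"]]])
      fix P assume "P \<in> curve"
      then obtain x y where P: "P = (x, y)" and "y i ^ p - y i = \<kappa> (a i) * x ^ m"
        using i(1) by (auto simp: curve_def)
      hence yp: "y i ^ p = y i + \<kappa> (a i) * x ^ m" by (simp add: algebra_simps)
      have "y i ^ e i = y i ^ p * y i ^ (e i - p)" using i(2) by (simp flip: power_add)
      hence "y i ^ e i = y i ^ (e i - p + 1) + \<kappa> (a i) * x ^ m * y i ^ (e i - p)"
        unfolding yp by (simp add: algebra_simps)
      thus "monomial t j e P = monomial t j e1 P + \<kappa> (a i) * monomial t (j + m) e2 P"
        unfolding P e1_def e2_def monomial_fun_upd[OF i(1)]
        by (simp add: algebra_simps power_add)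
    qed
  qed
qed

lemma monomial_mult: "monomial t j e P * monomial t j' e' P = monomial t (j + j') (\<lambda>i. e i + e' i) P"
  by (cases P) (simp add: monomial_def power_add prod.distrib mult_ac)

text \<open>Weights add when monomials are multiplied; a product whose exponents reach
  \<open>p\<close> is brought back to reduced form by \<open>L_monomial\<close>.\<close>

lemma L_mult:
  assumes "F \<in> L D" "G \<in> L D'" shows "(\<lambda>P. F P * G P) \<in> L (D + D')"
proof -
  from assms obtain c d where c: "\<forall>P\<in>curve. F P = lin_comb (idx D) c P"
    and d: "\<forall>P\<in>curve. G P = lin_comb (idx D') d P" by (auto simp: L_def)
  have "(\<lambda>P. \<Sum>u\<in>idx D. \<Sum>v\<in>idx D'. \<kappa> (c u * d v) *
      monomial t (fst u + fst v) (\<lambda>i. snd u i + snd v i) P) \<in> L (D + D')"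
  proof (intro L_sum L_scale L_monomial)
    fix u v assume "u \<in> idx D" "v \<in> idx D'"
    hence "weight (fst u) (snd u) \<le> D" "weight (fst v) (snd v) \<le> D'" by (auto simp: idx_def)
    thus "weight (fst u + fst v) (\<lambda>i. snd u i + snd v i) \<le> D + D'"
      by (simp add: weight_def sum.distrib algebra_simps)
  qed
  thus ?thesis
  proof (rule L_cong)
    fix P assume "P \<in> curve"
    thus "F P * G P = (\<Sum>u\<in>idx D. \<Sum>v\<in>idx D'. \<kappa> (c u * d v) *
      monomial t (fst u + fst v) (\<lambda>i. snd u i + snd v i) P)"
      using c d by (simp add: lin_comb_def sum_product kappa_mult mult_ac flip: monomial_mult)
  qed
qed

lemma L_const: "(\<lambda>P. \<kappa> k) \<in> L D"
proof -
  have "monomial t 0 (\<lambda>_. 0) \<in> L D" by (rule L_monomial) (simp add: weight_def)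
  from L_scale[OF this, of k] show ?thesis by (rule L_cong) (auto simp: monomial_def split: prod.splits)
qed

lemma L_one: "(\<lambda>P. 1) \<in> L D"
  using L_const[of 1] by (simp add: kappa_1)

lemma L_fst: "fst \<in> L p"
proof -
  have "monomial t 1 (\<lambda>_. 0) \<in> L p" by (rule L_monomial) (simp add: weight_def)
  thus ?thesis by (rule L_cong) (auto simp: monomial_def split: prod.splits)
qed

lemma L_snd: assumes "i \<in> {1..t}" shows "(\<lambda>P. snd P i) \<in> L m"
proof -
  have *: "monomial t 0 (\<lambda>k. if k = i then 1 else 0) P = snd P i" for P :: "'k point"
  proof -
    have "(\<Prod>k=1..t. snd P k ^ (if k = i then 1 else 0)) = (\<Prod>k=1..t. if k = i then snd P i else 1)"
      by (intro prod.cong) auto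
    thus ?thesis using assms by (cases P) (simp add: monomial_def)
  qed
  have "monomial t 0 (\<lambda>k. if k = i then 1 else 0) \<in> L m"
    by (rule L_monomial) (use assms in \<open>simp add: weight_def\<close>)
  thus ?thesis by (rule L_cong) (simp add: *)
qed

lemma L_power: assumes "F \<in> L D" shows "(\<lambda>P. F P ^ n) \<in> L (n * D)"
  by (induction n) (auto intro: L_one L_mult[OF assms])

lemma L_prod:
  "finite A \<Longrightarrow> (\<And>x. x \<in> A \<Longrightarrow> F x \<in> L D) \<Longrightarrow> (\<lambda>P. \<Prod>x\<in>A. F x P) \<in> L (card A * D)"
  by (induction A rule: finite_induct) (auto intro: L_one L_mult)

text \<open>At fixed weight, \<open>e 2, ..., e t\<close> determine \<open>m * e 1\<close> modulo
  \<open>p\<close>, hence \<open>e 1\<close>, as \<open>m\<close> is invertible modulo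
  \<open>p\<close> and \<open>e 1 < p\<close>, and then \<open>j\<close>.\<close>

lemma card_idx_Suc:
  assumes "t \<ge> 1" shows "card (idx (Suc D)) \<le> card (idx D) + p ^ (t - 1)"
proof -
  define W where "W = {(j, e). e \<in> {1..t} \<rightarrow>\<^sub>E {..<p} \<and> weight j e = Suc D}"
  have W: "idx (Suc D) = idx D \<union> W" by (auto simp: idx_def W_def le_Suc_eq)
  have "card W \<le> card ({2..t} \<rightarrow>\<^sub>E {..<p})"
  proof (rule card_inj_on_le)
    show "inj_on (\<lambda>(j, e). restrict e {2..t}) W"
    proof (rule inj_onI, clarify)
      fix j e j' e'
      assume "(j, e) \<in> W" "(j', e') \<in> W" and r: "restrict e {2..t} = restrict e' {2..t}"
      hence e: "e \<in> {1..t} \<rightarrow>\<^sub>E {..<p}" "e' \<in> {1..t} \<rightarrow>\<^sub>E {..<p}" and w: "weight j e = weight j' e'"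
        by (auto simp: W_def)
      have eq: "e i = e' i" if "i \<in> {2..t}" for i using fun_cong[OF r, of i] that by simp
      have T: "{1..t} = insert 1 {2..t}" using assms by auto
      have "(\<Sum>i=2..t. e i) = (\<Sum>i=2..t. e' i)" using eq by (intro sum.cong) auto
      hence w': "p * j + m * e 1 = p * j' + m * e' 1" using w unfolding weight_def T by (simp add: distrib_left)
      have "int p * int j + int m * int (e 1) = int p * int j' + int m * int (e' 1)"
        using w' by (metis of_nat_add of_nat_mult)
      hence "int p * (int j' - int j) = int m * (int (e 1) - int (e' 1))" by (simp add: algebra_simps)
      hence "int p dvd int m * (int (e 1) - int (e' 1))" by (metis dvd_triv_left)
      hence "int p dvd int (e 1) - int (e' 1)"
        using m_ndvd prime_p by (simp add: prime_dvd_mult_iff)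
      moreover have "e 1 < p" "e' 1 < p" using e assms by (auto simp: PiE_iff)
      ultimately have e1: "e 1 = e' 1"
        using dvd_imp_le_int[of "int (e 1) - int (e' 1)" "int p"] by linarith
      hence "e = e'" using eq T by (intro PiE_ext[OF e]) auto
      moreover have "j = j'" using w' e1 p2 by simp
      ultimately show "j = j' \<and> e = e'" by simp
    qed
    show "(\<lambda>(j, e). restrict e {2..t}) ` W \<subseteq> {2..t} \<rightarrow>\<^sub>E {..<p}"
    proof clarify
      fix j e assume "(j, e) \<in> W"
      thus "restrict e {2..t} \<in> {2..t} \<rightarrow>\<^sub>E {..<p}" by (auto simp: W_def PiE_iff)
    qed
  qed (auto intro: finite_PiE)
  also have "\<dots> = p ^ (t - 1)" by (simp add: card_PiE)
  finally show ?thesis unfolding W using card_Un_le[of "idx D" W] by linarith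
qed

lemma card_idx_add: "t \<ge> 1 \<Longrightarrow> card (idx (D + n)) \<le> card (idx D) + p ^ (t - 1) * n"
proof (induction n)
  case (Suc n) thus ?case using card_idx_Suc[of "D + n"] by simp
qed simp

text \<open>Collecting terms by their \<open>y\<close>-exponent gives polynomials in
  \<open>x\<close> as coefficients, to which \<open>Ymon_independent\<close> applies on the full box
  of exponents; distinct powers of \<open>x\<close> then separate.\<close>

lemma monomials_independent:
  assumes "finite U" "U \<subseteq> UNIV \<times> ({1..t} \<rightarrow>\<^sub>E {..<p})" "lin_comb U c (gx, Y) = 0" "u \<in> U"
  shows "c u = 0"
proof -
  define E where "E = {1..t} \<rightarrow>\<^sub>E {..<p}"
  have finE: "finite E" unfolding E_def by (auto intro: finite_PiE)
  have UE: "snd ` U \<subseteq> E" using assms(2) unfolding E_def by force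
  define R where "R e = (\<Sum>v\<in>{v\<in>U. snd v = e}. monom (c v) (fst v))" for e
  have "(\<Sum>e\<in>E. \<phi> (R e) * Ymon e) = (\<Sum>e\<in>E. \<Sum>v\<in>{v\<in>U. snd v = e}. \<kappa> (c v) * monomial t (fst v) (snd v) (gx, Y))"
    by (intro sum.cong refl)
       (simp add: R_def phi_sum phi_monom sum_distrib_left sum_distrib_right monomial_def Ymon_def mult_ac)
  also have "\<dots> = lin_comb U c (gx, Y)"
    unfolding lin_comb_def by (intro sum.group assms(1) finE UE)
  finally have "(\<Sum>e\<in>E. \<phi> (R e) * Ymon e) = 0" using assms by simp
  moreover have "snd u \<in> E" using assms(4) UE by blast
  ultimately have "R (snd u) = 0"
    by (intro Ymon_independent[of E R]) (use finE in \<open>auto simp: E_def PiE_iff\<close>, meson atLeastAtMost_iff le_less_trans)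
  hence "0 = coeff (R (snd u)) (fst u)" by simp
  also have "\<dots> = (\<Sum>v\<in>{v\<in>U. snd v = snd u}. if v = u then c u else 0)"
    unfolding R_def coeff_sum by (intro sum.cong) (auto simp: prod_eq_iff)
  also have "\<dots> = c u" using assms by simp
  finally show ?thesis by simp
qed

section \<open>Rational points and interpolation\<close>

definition emb :: "'a point \<Rightarrow> 'k point" where
  "emb Q = (\<kappa> (fst Q), \<lambda>i. \<kappa> (snd Q i))"

lemma monomial_emb: "monomial t j e (emb Q) = \<kappa> (monomial t j e Q)"
  by (cases Q) (simp add: monomial_def emb_def kappa_mult kappa_power kappa_prod)

lemma emb_in_curve:
  "(\<And>i. i \<in> {1..t} \<Longrightarrow> snd Q i ^ p - snd Q i = a i * fst Q ^ m) \<Longrightarrow> emb Q \<in> curve"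
  by (auto simp: curve_def emb_def simp flip: kappa_power kappa_mult kappa_diff)

text \<open>A Lagrange indicator of the rational point \<open>Q\<close>, with a weight bound that
  does not depend on \<open>Q\<close>.\<close>

definition delta :: "'a point \<Rightarrow> 'k point \<Rightarrow> 'k" where
  "delta Q P = (1 - (fst P - \<kappa> (fst Q)) ^ (CARD('a) - 1))
     * (\<Prod>i=1..t. 1 - (snd P i - \<kappa> (snd Q i)) ^ (p - 1))"

lemma L_delta: "delta Q \<in> L (p * (CARD('a) - 1) + t * (m * (p - 1)))"
proof -
  have 1: "(\<lambda>P. 1 - (fst P - \<kappa> (fst Q)) ^ (CARD('a) - 1)) \<in> L ((CARD('a) - 1) * p)"
    by (intro L_diff L_one L_power L_const L_fst)
  have "(\<lambda>P. \<Prod>i=1..t. 1 - (snd P i - \<kappa> (snd Q i)) ^ (p - 1)) \<in> L (card {1..t} * ((p - 1) * m))"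
    by (intro L_prod L_diff L_one L_power L_const L_snd) auto
  from L_mult[OF 1 this] have "delta Q \<in> L ((CARD('a) - 1) * p + card {1..t} * ((p - 1) * m))"
    by (rule L_cong) (simp add: delta_def)
  thus ?thesis by (simp add: mult_ac)
qed

text \<open>Different \<open>x\<close> make the first factor vanish by Fermat. Over the same
  \<open>x\<close>, a difference \<open>b\<close> of two roots satisfies \<open>b^p = b\<close>, so
  a nonzero one makes its factor vanish.\<close>

lemma delta_emb:
  assumes fin: "finite (UNIV :: 'a set)"
    and "\<And>i. i \<in> {1..t} \<Longrightarrow> snd Q i ^ p - snd Q i = a i * fst Q ^ m" "snd Q \<in> extensional {1..t}"
    and "\<And>i. i \<in> {1..t} \<Longrightarrow> snd R i ^ p - snd R i = a i * fst R ^ m" "snd R \<in> extensional {1..t}"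
  shows "delta Q (emb R) = (if R = Q then 1 else 0)"
proof -
  \<comment> \<open>The exponent must be positive: with \<open>0^0 = 1\<close> the indicator would
    vanish at \<open>Q\<close> itself.\<close>
  have q: "CARD('a) - 1 > 0"
    using card_mono[OF fin, of "{0, 1}"] by simp
  have d: "delta Q (emb R) = \<kappa> ((1 - (fst R - fst Q) ^ (CARD('a) - 1))
     * (\<Prod>i=1..t. 1 - (snd R i - snd Q i) ^ (p - 1)))"
    by (simp add: delta_def emb_def kappa_mult kappa_power kappa_prod kappa_1 kappa_diff del: diff_pCons)
  consider "R = Q" | "fst R \<noteq> fst Q" | "fst R = fst Q" "R \<noteq> Q" by blast
  thus ?thesis
  proof cases
    case 1 thus ?thesis using q p2 d by (simp add: kappa_1 power_0_left)
  next
    case 2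
    hence "(fst R - fst Q) ^ (CARD('a) - 1) = 1"
      by (intro finite_field_power_card_minus_1 fin) simp
    thus ?thesis using 2 by (auto simp: d)
  next
    case 3
    hence "snd R \<noteq> snd Q" by (auto simp: prod_eq_iff)
    then obtain i where i: "i \<in> {1..t}" "snd R i \<noteq> snd Q i"
      using assms(3,5) extensionalityI by metis
    define b where "b = snd R i - snd Q i"
    have "(snd Q i + b) ^ p = snd Q i ^ p + b ^ p"
      by (rule freshmans_dream) (use CHAR_p prime_p in auto)
    hence "b ^ p = b" using assms(2,4)[OF i(1)] 3(1) by (simp add: b_def algebra_simps)
    moreover have "b ^ p = b ^ (p - 1) * b" using p2 by (intro power_minus_mult[symmetric]) simp
    ultimately have "b ^ (p - 1) = 1" using i(2) by (simp add: b_def)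
    hence "\<exists>i\<in>{1..t}. 1 - (snd R i - snd Q i) ^ (p - 1) = 0" using i(1) by (intro bexI[of _ i]) (simp_all add: b_def)
    hence "(\<Prod>i=1..t. 1 - (snd R i - snd Q i) ^ (p - 1)) = 0" by simp
    thus ?thesis using 3 by (simp only: d) simp
  qed
qed

text \<open>With \<open>D\<close> so large that \<open>L D\<close> interpolates, \<open>(G, w) \<mapsto> F G + (interpolant of w)\<close> embeds
  \<open>L D\<close> times the functions on \<open>Z\<close> into \<open>L (D + n)\<close>: \<open>w\<close> is recovered on \<open>Z\<close>, then \<open>G\<close> at the generic point.\<close>

theorem card_zeros_le:
  assumes fin: "finite (UNIV :: 'a set)" and t: "t \<ge> 1"
    and F: "F \<in> L n" and F0: "F (gx, Y) \<noteq> 0"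
    and Z: "\<And>Q i. Q \<in> Z \<Longrightarrow> i \<in> {1..t} \<Longrightarrow> snd Q i ^ p - snd Q i = a i * fst Q ^ m"
      "\<And>Q. Q \<in> Z \<Longrightarrow> snd Q \<in> extensional {1..t}"
    and finZ: "finite Z"
    and FZ: "\<And>Q. Q \<in> Z \<Longrightarrow> F (emb Q) = 0"
  shows "card Z \<le> p ^ (t - 1) * n"
proof -
  \<comment> \<open>The weight bound of every \<open>delta\<close>, so any values on
    \<open>Z\<close> are interpolated inside \<open>L D\<close>.\<close>
  define D where "D = p * (CARD('a) - 1) + t * (m * (p - 1))"
  define H where "H w P = (\<Sum>Q\<in>Z. \<kappa> (w Q) * delta Q P)" for w P
  have HL: "H w \<in> L D" for w
    unfolding H_def[abs_def] D_def by (intro L_sum L_scale L_delta)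
  have Hemb: "H w (emb R) = \<kappa> (w R)" if "R \<in> Z" for w R
  proof -
    have "H w (emb R) = (\<Sum>Q\<in>Z. if Q = R then \<kappa> (w Q) else 0)"
      unfolding H_def
    proof (intro sum.cong refl)
      fix Q assume "Q \<in> Z"
      hence "delta Q (emb R) = (if R = Q then 1 else 0)" using that Z by (intro delta_emb[OF fin]) auto
      thus "\<kappa> (w Q) * delta Q (emb R) = (if Q = R then \<kappa> (w Q) else 0)" by simp
    qed
    thus ?thesis using that finZ by simp
  qed
  have embZ: "emb Q \<in> curve" if "Q \<in> Z" for Q using that Z by (intro emb_in_curve)
  have "\<exists>c \<in> idx (D + n) \<rightarrow>\<^sub>E UNIV. \<forall>P\<in>curve.
      F P * lin_comb (idx D) g P + H w P = lin_comb (idx (D + n)) c P" for g w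
  proof -
    have "lin_comb (idx D) g \<in> L D" by (auto simp: L_def)
    hence "(\<lambda>P. F P * lin_comb (idx D) g P) \<in> L (D + n)" using L_mult[OF F] by (simp add: add.commute)
    moreover have "H w \<in> L (D + n)" by (rule L_mono[OF HL]) simp
    ultimately have "(\<lambda>P. F P * lin_comb (idx D) g P + H w P) \<in> L (D + n)" by (rule L_add)
    then obtain c where "\<forall>P\<in>curve. F P * lin_comb (idx D) g P + H w P = lin_comb (idx (D + n)) c P"
      by (auto simp: L_def)
    thus ?thesis by (intro bexI[of _ "restrict c (idx (D + n))"]) (auto simp: lin_comb_def)
  qed
  then obtain T where T: "\<And>g w. T g w \<in> idx (D + n) \<rightarrow>\<^sub>E UNIV"
    "\<And>g w P. P \<in> curve \<Longrightarrow> F P * lin_comb (idx D) g P + H w P = lin_comb (idx (D + n)) (T g w) P"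
    by metis
  have "card ((idx D \<rightarrow>\<^sub>E (UNIV :: 'a set)) \<times> (Z \<rightarrow>\<^sub>E (UNIV :: 'a set))) \<le> card (idx (D + n) \<rightarrow>\<^sub>E (UNIV :: 'a set))"
  proof (rule card_inj_on_le)
    show "finite (idx (D + n) \<rightarrow>\<^sub>E (UNIV :: 'a set))" using fin finite_idx by (intro finite_PiE) auto
    show "(\<lambda>(g, w). T g w) ` ((idx D \<rightarrow>\<^sub>E UNIV) \<times> (Z \<rightarrow>\<^sub>E UNIV)) \<subseteq> idx (D + n) \<rightarrow>\<^sub>E UNIV"
      using T(1) by auto
    show "inj_on (\<lambda>(g, w). T g w) ((idx D \<rightarrow>\<^sub>E UNIV) \<times> (Z \<rightarrow>\<^sub>E UNIV))"
    proof (rule inj_onI, clarify)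
      fix g w g' w'
      assume g: "g \<in> idx D \<rightarrow>\<^sub>E (UNIV :: 'a set)" "g' \<in> idx D \<rightarrow>\<^sub>E (UNIV :: 'a set)"
        and w: "w \<in> Z \<rightarrow>\<^sub>E (UNIV :: 'a set)" "w' \<in> Z \<rightarrow>\<^sub>E (UNIV :: 'a set)"
        and "T g w = T g' w'"
      hence eq: "F P * lin_comb (idx D) g P + H w P = F P * lin_comb (idx D) g' P + H w' P"
        if "P \<in> curve" for P using T(2)[OF that] by simp
      have "w Q = w' Q" if "Q \<in> Z" for Q
        using eq[OF embZ[OF that]] FZ[OF that] Hemb[OF that] by (simp add: kappa_eq_iff)
      hence ww: "w = w'" by (intro PiE_ext[OF w]) auto
      hence "lin_comb (idx D) g (gx, Y) = lin_comb (idx D) g' (gx, Y)"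
        using eq[OF generic_point_in_curve] F0 by simp
      hence *: "lin_comb (idx D) (\<lambda>u. g u - g' u) (gx, Y) = 0"
        by (simp add: lin_comb_def kappa_diff sum_subtractf left_diff_distrib del: diff_pCons)
      have "g u - g' u = 0" if "u \<in> idx D" for u
        by (rule monomials_independent[OF finite_idx _ * that]) (auto simp: idx_def)
      hence "g = g'" by (intro PiE_ext[OF g]) auto
      thus "g = g' \<and> w = w'" using ww by simp
    qed
  qed
  hence "CARD('a) ^ (card (idx D) + card Z) \<le> CARD('a) ^ card (idx (D + n))"
    by (simp add: card_cartesian_product card_PiE finite_idx finZ power_add)
  moreover have "CARD('a) > 1" using card_mono[OF fin, of "{0, 1}"] by simp
  ultimately have "card (idx D) + card Z \<le> card (idx (D + n))" by (simp add: power_increasing_iff)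
  thus ?thesis using card_idx_add[OF t, of D n] by linarith
qed

end

text \<open>A generic point exists in the algebraic closure of the rational function field, each
  \<open>Y i\<close> being a root of \<open>y^p - y - a_i x^m\<close>. A nonzero coefficient makes
  the function nonzero there, so \<open>card_zeros_le\<close> applies.\<close>

lemma card_zeros_bound:
  fixes a :: "nat \<Rightarrow> 'a::{field,finite}"
  assumes "prime p" "CHAR('a) = p" "\<not> p dvd m" "t \<ge> 1"
    and indep: "\<And>(c :: nat \<Rightarrow> nat) i. (\<Sum>i=1..t. of_nat (c i) * a i) = 0 \<Longrightarrow> i \<in> {1..t} \<Longrightarrow> (of_nat (c i) :: 'a) = 0"
    and U: "finite U" "U \<subseteq> UNIV \<times> ({1..t} \<rightarrow>\<^sub>E {..<p})"
    and wt: "\<And>j e. (j, e) \<in> U \<Longrightarrow> p * j + m * (\<Sum>i=1..t. e i) \<le> n"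
    and u0: "u0 \<in> U" "c u0 \<noteq> 0"
    and Z: "\<And>Q i. Q \<in> Z \<Longrightarrow> i \<in> {1..t} \<Longrightarrow> snd Q i ^ p - snd Q i = a i * fst Q ^ m"
      "\<And>Q. Q \<in> Z \<Longrightarrow> snd Q \<in> extensional {1..t}"
    and finZ: "finite Z"
    and FZ: "\<And>Q. Q \<in> Z \<Longrightarrow> (\<Sum>u\<in>U. c u * monomial t (fst u) (snd u) Q) = 0"
  shows "card Z \<le> p ^ (t - 1) * n"
proof -
  define \<phi> :: "'a poly \<Rightarrow> 'a poly fract alg_closure" where "\<phi> P = to_ac (to_fract P)" for P
  have "\<exists>y. y ^ p = y + \<phi> (monom (a i) m)" for i
  proof -
    have p2: "p \<ge> 2" using assms(1) by (rule prime_ge_2_nat)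
    define f where "f = monom 1 p + - ([:\<phi> (monom (a i) m), 1:])"
    have "degree f = degree (monom (1 :: 'a poly fract alg_closure) p)"
      unfolding f_def by (rule degree_add_eq_left) (use p2 in \<open>simp add: degree_monom_eq\<close>)
    hence "degree f > 0" using p2 by (simp add: degree_monom_eq)
    then obtain y where "poly f y = 0" using alg_closed_imp_poly_has_root by blast
    thus ?thesis by (intro exI[of _ y]) (simp add: f_def poly_monom algebra_simps)
  qed
  then obtain Y where Y: "\<And>i. Y i ^ p = Y i + \<phi> (monom (a i) m)" by metis
  interpret artin_schreier_point p m t a \<phi> Y
    by standard (use assms indep Y in \<open>auto simp: \<phi>_def\<close>)
  have "lin_comb U c (gx, Y) \<noteq> 0" using monomials_independent[OF U _ u0(1)] u0(2) by blast
  moreover have "lin_comb U c \<in> L n"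
    unfolding lin_comb_def[abs_def]
    by (intro L_sum L_scale L_monomial) (use wt in \<open>auto simp: weight_def\<close>)
  moreover have "lin_comb U c (emb Q) = 0" if "Q \<in> Z" for Q
  proof -
    have "lin_comb U c (emb Q) = \<kappa> (\<Sum>u\<in>U. c u * monomial t (fst u) (snd u) Q)"
      by (simp add: lin_comb_def monomial_emb kappa_sum kappa_mult)
    thus ?thesis using FZ[OF that] by simp
  qed
  ultimately show ?thesis using assms(4) Z finZ by (intro card_zeros_le[of "lin_comb U c"]) auto
qed

section \<open>Finite fields and fibers of the Artin-Schreier map\<close>

lemma CHAR_finite_field:
  assumes "prime p" "CARD('a::{field,finite}) = p ^ n"
  shows "CHAR('a) = p"
proof -
  \<comment> \<open>Translation by 1 permutes the field, so the field size times 1 vanishes.\<close>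
  have "(\<Sum>x\<in>UNIV. x) = (\<Sum>x\<in>UNIV. x + 1 :: 'a)"
    by (rule sum.reindex_bij_witness[of _ "\<lambda>x. x + 1" "\<lambda>x. x - 1"]) auto
  hence "(of_nat (CARD('a)) :: 'a) = 0" by (simp add: sum.distrib)
  hence "(of_nat p :: 'a) = 0" using assms(2) by simp
  hence "CHAR('a) dvd p" by (simp add: of_nat_eq_0_iff_char_dvd)
  thus ?thesis using assms(1) CHAR_not_1'[where 'a = 'a] by (auto simp: prime_nat_iff)
qed

text \<open>The freshman's dream for \<open>(x - y) + y\<close>, which avoids the sign of
  \<open>(-1)^p\<close>.\<close>

lemma frobenius_diff:
  fixes x y :: "'a::field"
  assumes "prime p" "CHAR('a) = p"
  shows "(x - y) ^ (p ^ n) = x ^ (p ^ n) - y ^ (p ^ n)"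
proof -
  have "((x - y) + y) ^ (p ^ n) = (x - y) ^ (p ^ n) + y ^ (p ^ n)"
    by (rule freshmans_dream'[of _ n]) (use assms in auto)
  thus ?thesis by (simp add: algebra_simps)
qed

text \<open>Additive Hilbert 90 by counting. The additive map \<open>y^p - y\<close> has fibers of
  size \<open>p\<close>, so its image has \<open>p^(n-1)\<close> elements. The image lies in the
  trace kernel, which is no larger, being the root set of a nonzero polynomial of degree at most
  \<open>p^(n-1)\<close>. The two agree, so \<open>b\<close> has a preimage.\<close>

lemma card_artin_schreier_fiber:
  fixes b :: "'a::{field,finite}"
  assumes "prime p" "CARD('a) = p ^ n" "n \<ge> 1" and trace: "(\<Sum>i<n. b ^ (p ^ i)) = 0"
  shows "card {y :: 'a. y ^ p - y = b} = p"
proof -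
  have ch: "CHAR('a) = p" using CHAR_finite_field assms(1,2) by blast
  have p2: "p \<ge> 2" using assms(1) by (rule prime_ge_2_nat)
  define f :: "'a \<Rightarrow> 'a" where "f y = y ^ p - y" for y
  define K where "K = {z :: 'a. (\<Sum>i<n. z ^ (p ^ i)) = 0}"
  have fd: "f (x - y) = f x - f y" for x y
    using frobenius_diff[OF assms(1) ch, of x y 1] by (simp add: f_def)
  have fiber: "card {y. f y = f x} = p" for x
  proof -
    have "bij_betw (\<lambda>y. x - y) {z. f z = 0} {y. f y = f x}"
      by (rule bij_betw_byWitness[of _ "\<lambda>y. x - y"]) (auto simp: fd)
    moreover have "{z. f z = 0} = {z. z ^ p = z}" by (simp add: f_def)
    ultimately show ?thesis using frobenius_fixed_points(2)[OF assms(1) ch] by (metis bij_betw_same_card)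
  qed
  have "CARD('a) = (\<Sum>x\<in>(UNIV::'a set). 1)" by simp
  also have "\<dots> = (\<Sum>c\<in>range f. \<Sum>x\<in>{x\<in>UNIV. f x = c}. 1)"
    by (rule sum.image_gen) simp
  also have "\<dots> = (\<Sum>c\<in>range f. p)" by (intro sum.cong refl) (use fiber in auto)
  also have "\<dots> = card (range f) * p" by simp
  finally have "card (range f) * p = p ^ n" using assms(2) by simp
  also have "\<dots> = p ^ (n - 1) * p" using assms(3) by (intro power_minus_mult[symmetric]) simp
  finally have cr: "card (range f) = p ^ (n - 1)" using p2 by simp
  have "range f \<subseteq> K"
  proof
    fix z assume "z \<in> range f"
    then obtain y where z: "z = y ^ p - y" by (auto simp: f_def)
    \<comment> \<open>The trace of \<open>y^p - y\<close> telescopes to \<open>y^(p^n) - y\<close>,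
      which is 0.\<close>
    have "(\<Sum>i<n. z ^ (p ^ i)) = (\<Sum>i<n. y ^ (p ^ Suc i) - y ^ (p ^ i))"
      by (simp add: z frobenius_diff[OF assms(1) ch] flip: power_mult)
    also have "\<dots> = y ^ (p ^ n) - y ^ (p ^ 0)" by (rule sum_lessThan_telescope)
    also have "y ^ (p ^ n) = y" using finite_field_power_card[of y] assms(2) by simp
    finally show "z \<in> K" by (simp add: K_def)
  qed
  moreover have "card K \<le> p ^ (n - 1)"
  proof -
    define P :: "'a poly" where "P = (\<Sum>i<n. monom 1 (p ^ i))"
    have "coeff P (p ^ (n - 1)) = (\<Sum>i<n. if i = n - 1 then 1 else 0)"
      unfolding P_def coeff_sum using p2 by (intro sum.cong) (auto simp: power_inject_exp)
    hence "P \<noteq> 0" using assms(3) by auto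
    have "degree P \<le> p ^ (n - 1)"
      unfolding P_def
    proof (rule degree_sum_le)
      fix i assume "i \<in> {..<n}"
      hence "p ^ i \<le> p ^ (n - 1)" using p2 by (intro power_increasing) auto
      thus "degree (monom (1::'a) (p ^ i)) \<le> p ^ (n - 1)" by (simp add: degree_monom_eq)
    qed simp
    moreover have "K = {z. poly P z = 0}" by (simp add: K_def P_def poly_sum poly_monom)
    ultimately show ?thesis using card_poly_roots_bound[OF \<open>P \<noteq> 0\<close>] by simp
  qed
  ultimately have "range f = K" using cr by (intro card_seteq) auto
  moreover have "b \<in> K" using trace by (simp add: K_def)
  ultimately obtain x where "b = f x" by auto
  thus ?thesis using fiber[of x] by (simp add: f_def)
qed

section \<open>Spans and dimensions of indexed families\<close>

lemma sum_fun_apply: "(\<Sum>u\<in>A. f u) x = (\<Sum>u\<in>A. f u x :: 'a::comm_monoid_add)"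
  by (induction A rule: infinite_finite_induct) auto

lemma span_image_eq_sums:
  fixes g :: "'u \<Rightarrow> 'b \<Rightarrow> 'a::field"
  assumes "finite J"
  shows "fun_vs.span (g ` J) = {\<lambda>x. \<Sum>u\<in>J. c u * g u x | c. True}" (is "_ = ?R")
proof (rule fun_vs.span_unique)
  show "g ` J \<subseteq> ?R"
  proof clarify
    fix v assume "v \<in> J"
    have "g v x = (\<Sum>u\<in>J. (if u = v then 1 else 0) * g u x)" for x
    proof -
      have "(\<Sum>u\<in>J. (if u = v then 1 else 0) * g u x) = (\<Sum>u\<in>J. if u = v then g v x else 0)"
        by (intro sum.cong) auto
      thus ?thesis using \<open>v \<in> J\<close> assms by simp
    qed
    thus "\<exists>c. g v = (\<lambda>x. \<Sum>u\<in>J. c u * g u x) \<and> True" by (intro exI[of _ "\<lambda>u. if u = v then 1 else 0"]) auto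
  qed
  show "fun_vs.subspace ?R"
  proof (rule fun_vs.subspaceI)
    show "0 \<in> ?R" by (auto simp: zero_fun_def intro!: exI[of _ "\<lambda>_. 0"])
  next
    fix x y assume "x \<in> ?R" "y \<in> ?R"
    then obtain c d where "x = (\<lambda>x. \<Sum>u\<in>J. c u * g u x)" "y = (\<lambda>x. \<Sum>u\<in>J. d u * g u x)" by auto
    thus "x + y \<in> ?R"
      by (auto simp: plus_fun_def sum.distrib algebra_simps intro!: exI[of _ "\<lambda>u. c u + d u"])
  next
    fix k x assume "x \<in> ?R"
    then obtain c where "x = (\<lambda>x. \<Sum>u\<in>J. c u * g u x)" by auto
    thus "fun_scale k x \<in> ?R"
      by (auto simp: fun_scale_def sum_distrib_left algebra_simps intro!: exI[of _ "\<lambda>u. k * c u"])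
  qed
  fix S assume S: "g ` J \<subseteq> S" "fun_vs.subspace S"
  show "?R \<subseteq> S"
  proof clarify
    fix c
    have "(\<lambda>x. \<Sum>u\<in>J. c u * g u x) = (\<Sum>u\<in>J. fun_scale (c u) (g u))"
      by (auto simp: fun_eq_iff fun_scale_def sum_fun_apply)
    also have "\<dots> \<in> S" using S by (intro fun_vs.subspace_sum fun_vs.subspace_scale) auto
    finally show "(\<lambda>x. \<Sum>u\<in>J. c u * g u x) \<in> S" .
  qed
qed

text \<open>Independence of the family forces distinct members, since \<open>g u = g v\<close> would
  give a relation with coefficients 1 and -1; so the image is a basis with as many elements as
  \<open>J\<close>.\<close>

lemma dim_span_family:
  fixes g :: "'u \<Rightarrow> 'b \<Rightarrow> 'a::field"
  assumes "finite J"
    and indep: "\<And>c u. (\<And>x. (\<Sum>u\<in>J. c u * g u x) = 0) \<Longrightarrow> u \<in> J \<Longrightarrow> c u = 0"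
  shows "fun_vs.dim (fun_vs.span (g ` J)) = card J"
proof -
  have inj: "inj_on g J"
  proof (rule inj_onI, rule ccontr)
    fix u v assume uv: "u \<in> J" "v \<in> J" "g u = g v" "u \<noteq> v"
    define c :: "'u \<Rightarrow> 'a" where "c w = (if w = u then 1 else 0) - (if w = v then 1 else 0)" for w
    have "(\<Sum>w\<in>J. c w * g w x) = (\<Sum>w\<in>J. (if w = u then g u x else 0) - (if w = v then g v x else 0))" for x
      by (intro sum.cong) (auto simp: c_def)
    hence "(\<Sum>w\<in>J. c w * g w x) = 0" for x
      using uv assms(1) by (simp add: sum_subtractf)
    hence "c u = 0" using indep uv(1) by blast
    thus False using uv(4) by (simp add: c_def)
  qed
  have "\<not> fun_vs.dependent (g ` J)"
  proof
    assume "fun_vs.dependent (g ` J)"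
    then obtain d v where d: "v \<in> g ` J" "d v \<noteq> 0" "(\<Sum>v\<in>g ` J. fun_scale (d v) v) = 0"
      using fun_vs.dependent_finite[of "g ` J"] assms(1) by auto
    have "(\<Sum>u\<in>J. d (g u) * g u x) = 0" for x
    proof -
      have "(\<Sum>u\<in>J. fun_scale (d (g u)) (g u)) = 0" using d(3) by (simp add: sum.reindex[OF inj])
      from fun_cong[OF this, of x] show ?thesis by (simp add: sum_fun_apply fun_scale_def)
    qed
    hence "\<And>u. u \<in> J \<Longrightarrow> d (g u) = 0" using indep[of "\<lambda>u. d (g u)"] by blast
    thus False using d by auto
  qed
  thus ?thesis using fun_vs.dim_span_eq_card_independent card_image[OF inj] by metis
qed

text \<open>The recovery function may return entry \<open>i\<close> of any codeword with the given
  restriction; by hypothesis the choice does not matter.\<close>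

lemma recoversI:
  assumes "\<And>c c'. c \<in> C \<Longrightarrow> c' \<in> C \<Longrightarrow> (\<And>k. k \<in> S \<Longrightarrow> c k = c' k) \<Longrightarrow> c i = c' i"
  shows "recovers C i S"
  unfolding recovers_def
proof (intro exI ballI)
  fix c assume c: "c \<in> C"
  define c' where "c' = (SOME c'. c' \<in> C \<and> restrict c' S = restrict c S)"
  have "c' \<in> C \<and> restrict c' S = restrict c S" unfolding c'_def by (rule someI[of _ c]) (use c in auto)
  hence "c' \<in> C" "\<And>k. k \<in> S \<Longrightarrow> c k = c' k" by (auto dest: fun_cong simp: restrict_def) (metis)
  hence "c i = c' i" by (rule assms[OF c])
  thus "c i = (\<lambda>r. (SOME c'. c' \<in> C \<and> restrict c' S = r) i) (restrict c S)" by (simp add: c'_def)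
qed

section \<open>The code\<close>

text \<open>Raising to the power \<open>p^h\<close> fixes the norm \<open>x^(p^h+1)\<close> and
  negates \<open>a\<close>, so their product is negated and the two halves of its trace
  cancel.\<close>

lemma card_fiber:
  fixes a x :: "'a::{field,finite}"
  assumes "prime p" "h \<ge> 1" "CARD('a) = p ^ (2 * h)" and a: "a ^ (p ^ h) + a = 0"
  shows "card {y. y ^ p - y = a * x ^ (p ^ h + 1)} = p"
proof (rule card_artin_schreier_fiber[OF assms(1,3)])
  have ch: "CHAR('a) = p" using CHAR_finite_field assms(1,3) by blast
  have p2: "p \<ge> 2" using assms(1) by (rule prime_ge_2_nat)
  define b where "b = a * x ^ (p ^ h + 1)"
  have xq: "x ^ (p ^ (2 * h)) = x" using finite_field_power_card[of x] assms(3) by simp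
  have "b ^ (p ^ h) = a ^ (p ^ h) * (x ^ (p ^ (2 * h)) * x ^ (p ^ h))"
    by (simp add: b_def power_mult_distrib power_add power_commutes mult_2 flip: power_mult)
  also have "a ^ (p ^ h) = - a" using a by (simp add: eq_neg_iff_add_eq_0)
  finally have bh: "b ^ (p ^ h) = 0 - b" by (simp add: b_def xq)
  have cancel: "b ^ (p ^ (h + i)) = - (b ^ (p ^ i))" for i
  proof -
    have "b ^ (p ^ (h + i)) = (0 - b) ^ (p ^ i)" by (simp only: power_add power_mult bh)
    also have "\<dots> = 0 ^ (p ^ i) - b ^ (p ^ i)" by (rule frobenius_diff[OF assms(1) ch])
    finally show ?thesis using p2 by (simp add: power_0_left)
  qed
  have split: "(\<Sum>i<h + k. f i) = (\<Sum>i<h. f i) + (\<Sum>i<k. f (h + i))" for f :: "nat \<Rightarrow> 'a" and k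
    by (induction k) (auto simp: add.assoc)
  have "(\<Sum>i<2 * h. b ^ (p ^ i)) = 0"
    unfolding mult_2 split by (simp add: cancel sum_negf)
  thus "(\<Sum>i<2 * h. (a * x ^ (p ^ h + 1)) ^ (p ^ i)) = 0" by (simp only: b_def)
qed (use assms in auto)

lemma affine_points_eq_Sigma:
  "affine_points p h t a =
     (SIGMA x:UNIV. PiE {1..t} (\<lambda>i. {y. y ^ p - y = a i * x ^ (p ^ h + 1)}))"
  by (auto simp: affine_points_def PiE_iff extensional_def)

lemma card_affine_points:
  fixes a :: "nat \<Rightarrow> 'a::{field,finite}"
  assumes "\<And>i x. i \<in> {1..t} \<Longrightarrow> card {y. y ^ p - y = a i * x ^ (p ^ h + 1)} = p"
  shows "card (affine_points p h t a) = p ^ t * CARD('a)"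
proof -
  have "card (PiE {1..t} (\<lambda>i. {y. y ^ p - y = a i * x ^ (p ^ h + 1)})) = p ^ t" for x
    using assms by (simp add: card_PiE)
  thus ?thesis unfolding affine_points_eq_Sigma
    by (subst card_SigmaI) (auto intro!: finite_PiE)
qed

text \<open>Unit coefficient vectors show that each \<open>a i\<close> lies in the space;
  coefficients on the first \<open>t\<close> elements are extended by zero.\<close>

lemma basis_over_prime_subfield:
  fixes a :: "nat \<Rightarrow> 'a::field"
  assumes "basis_over prime_subfield {z :: 'a. z ^ (p ^ h) + z = 0} {1..h} a" and "t \<le> h"
  shows "i \<in> {1..h} \<Longrightarrow> a i ^ (p ^ h) + a i = 0"
    and "(\<Sum>i=1..t. of_nat (c i) * a i) = 0 \<Longrightarrow> i \<in> {1..t} \<Longrightarrow> (of_nat (c i) :: 'a) = 0"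
proof -
  have nat_mem: "of_nat k \<in> (prime_subfield :: 'a set)" for k
    unfolding prime_subfield_def by (metis of_int_of_nat_eq rangeI)
  have gen: "{z. z ^ (p ^ h) + z = 0} = {\<Sum>i=1..h. c i * a i | c. c \<in> {1..h} \<rightarrow> prime_subfield}"
    and ind: "\<And>c. c \<in> {1..h} \<rightarrow> prime_subfield \<Longrightarrow> (\<Sum>i=1..h. c i * a i) = 0 \<Longrightarrow> \<forall>i\<in>{1..h}. c i = 0"
    using assms(1) by (auto simp: basis_over_def)
  show "a i ^ (p ^ h) + a i = 0" if i: "i \<in> {1..h}"
  proof -
    define c :: "nat \<Rightarrow> 'a" where "c k = of_nat (if k = i then 1 else 0)" for k
    have "(\<Sum>k=1..h. c k * a k) = (\<Sum>k=1..h. if k = i then a i else 0)"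
      by (intro sum.cong) (auto simp: c_def)
    also have "\<dots> = a i" using i by simp
    finally have "a i \<in> {\<Sum>i=1..h. c i * a i | c. c \<in> {1..h} \<rightarrow> prime_subfield}"
      using nat_mem by (auto simp: c_def simp del: of_nat_eq_of_nat_power_cancel_iff intro!: exI[of _ c])
    thus ?thesis unfolding gen[symmetric] by simp
  qed
  show "(of_nat (c i) :: 'a) = 0" if "(\<Sum>i=1..t. of_nat (c i) * a i) = 0" "i \<in> {1..t}"
  proof -
    define d :: "nat \<Rightarrow> 'a" where "d k = of_nat (if k \<le> t then c k else 0)" for k
    have "(\<Sum>k=1..h. d k * a k) = (\<Sum>k=1..t. of_nat (c k) * a k)"
      by (rule sum.mono_neutral_cong_right) (use assms(2) in \<open>auto simp: d_def\<close>)
    hence "\<forall>i\<in>{1..h}. d i = 0" using that(1) nat_mem by (intro ind) (auto simp only: d_def Pi_iff)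
    thus ?thesis using that(2) assms(2) by (force simp: d_def)
  qed
qed

text \<open>Restricting an exponent function to \<open>{1..t}\<close> does not change the monomial,
  so a finite index set gives the same span.\<close>

lemma eval_space_eq_sums:
  assumes "J = {..nat l} \<times> ({1..t} \<rightarrow>\<^sub>E {..p - 2})" "l \<ge> 0"
  shows "(eval_space p t l :: ('a::field point \<Rightarrow> 'a) set) = {\<lambda>P. \<Sum>u\<in>J. c u * monomial t (fst u) (snd u) P | c. True}"
proof -
  have "{monomial t j e | j e. int j \<le> l \<and> (\<forall>i\<in>{1..t}. e i \<le> p - 2)}
      = (\<lambda>u. monomial t (fst u) (snd u) :: 'a point \<Rightarrow> 'a) ` J" (is "?L = ?R")
  proof (intro subset_antisym subsetI)
    fix f assume "f \<in> ?L"
    then obtain j e where f: "f = monomial t j e" "int j \<le> l" "\<forall>i\<in>{1..t}. e i \<le> p - 2" by auto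
    have "f = monomial t j (restrict e {1..t})" by (auto simp: f monomial_def)
    moreover have "(j, restrict e {1..t}) \<in> J" using f assms by auto
    ultimately show "f \<in> ?R" by force
  next
    fix f assume "f \<in> ?R"
    then obtain j e where "f = monomial t j e" "j \<le> nat l" "e \<in> {1..t} \<rightarrow>\<^sub>E {..p - 2}"
      using assms by auto
    moreover from this have "int j \<le> l" using assms(2) by linarith
    ultimately show "f \<in> ?L" by (auto simp: PiE_iff)
  qed
  moreover have "finite J" unfolding assms(1) by (auto intro: finite_PiE)
  ultimately show ?thesis unfolding eval_space_def by (simp add: span_image_eq_sums)
qed


lemma poly_eq_0_if_card_roots_gt_degree:
  fixes g :: "'a::idom poly"
  assumes "degree g < card S" "\<And>y. y \<in> S \<Longrightarrow> poly g y = 0"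
  shows "g = 0"
proof (rule ccontr)
  assume g: "g \<noteq> 0"
  have "card S \<le> card {y. poly g y = 0}" using assms(2) poly_roots_finite[OF g] by (intro card_mono) auto
  thus False using card_poly_roots_bound[OF g] assms(1) by simp
qed

theorem theorem7p1:
  fixes p h t n :: nat
    and l :: int
    and a :: "nat \<Rightarrow> 'a::{field,finite}"
    and Q :: "nat \<Rightarrow> 'a point"
    and C :: "(nat \<Rightarrow> 'a) set"
  assumes "prime p" and "h \<ge> 1"
    and "CARD('a) = p ^ (2 * h)"
    and "basis_over prime_subfield {z :: 'a. z ^ (p ^ h) + z = 0} {1..h} a"
    and "1 \<le> t" and "t \<le> h"
    and "bij_betw Q {1..n} (affine_points p h t a)"
    and "l = int (p ^ (2 * h)) - int t * int p ^ h + 2 * int t * int p ^ (h - 1) - int t"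
    and "C = evaluation n Q ` eval_space p t l"
  shows "linear_code n C
    \<and> n = p ^ t * p ^ (2 * h)
    \<and> int (fun_vs.dim C) =
          (int (p ^ (2 * h)) - int t * int p ^ h + 2 * int t * int p ^ (h - 1) - int t + 1)
            * (int p - 1) ^ t
    \<and> min_distance n C \<ge> 2 * t * p ^ (t - 1)
    \<and> has_availability_locality n C t (\<lambda>_. p - 1)
    \<and> recovery_system n C t (\<lambda>_. p - 1) (fiber_recovery_set n t Q)"
proof -

  \<comment> \<open>The field, the curve and its number of points\<close>
  have p2: "p \<ge> 2" using assms(1) by (rule prime_ge_2_nat)
  have ch: "CHAR('a) = p" using CHAR_finite_field assms(1,3) by blast
  note basis = basis_over_prime_subfield[OF assms(4,6)]
  define m where "m = p ^ h + 1"
  define B where "B = affine_points p h t a"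
  have m_ndvd: "\<not> p dvd m"
  proof
    assume "p dvd m"
    moreover have "p dvd p ^ h" using assms(2) by (simp add: dvd_power)
    ultimately have "p dvd 1" unfolding m_def using dvd_add_right_iff by blast
    thus False using p2 by simp
  qed
  have fib: "card {y. y ^ p - y = a i * x ^ (p ^ h + 1)} = p" if "i \<in> {1..t}" for i x
    using that assms(6) by (intro card_fiber assms(1-3) basis(1)) auto
  have cardB: "card B = p ^ t * p ^ (2 * h)"
    unfolding B_def using card_affine_points[OF fib] assms(3) by simp
  have finB: "finite B" using cardB p2 by (intro card_ge_0_finite) simp
  have n: "n = p ^ t * p ^ (2 * h)"
    using bij_betw_same_card[OF assms(7)] cardB by (simp add: B_def)
  have QB: "Q i \<in> B" if "i \<in> {1..n}" for i
    using assms(7) that by (auto simp: B_def bij_betw_def)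
  have injQ: "inj_on Q {1..n}" using assms(7) by (simp add: bij_betw_def)
  have Beq: "snd P i ^ p - snd P i = a i * fst P ^ m" if "P \<in> B" "i \<in> {1..t}" for P i
    using that unfolding B_def affine_points_def m_def by auto
  have Bext: "snd P \<in> extensional {1..t}" if "P \<in> B" for P
    using that by (auto simp: B_def affine_points_def PiE_iff)

  \<comment> \<open>Ensures that \<open>nat l\<close> loses nothing:
    \<open>t <= h < 2^h <= p^h\<close> gives \<open>t p^h <= q\<close>, and
    \<open>2 p^(h-1) >= 1\<close> pays for the last \<open>- t\<close>.\<close>
  have l0: "l \<ge> 0"
  proof -
    have "h < 2 ^ h" by (rule less_exp)
    also have "(2::nat) ^ h \<le> p ^ h" using p2 by (rule power_mono) simp
    finally have "t \<le> p ^ h" using assms(6) by simp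
    hence "t * p ^ h \<le> p ^ h * p ^ h" by (rule mult_right_mono) simp
    hence "int (t * p ^ h) \<le> int (p ^ (2 * h))" by (simp only: mult_2 power_add of_nat_le_iff)
    moreover have "1 \<le> 2 * p ^ (h - 1)" using p2 by simp
    hence "t * 1 \<le> t * (2 * p ^ (h - 1))" by (rule mult_left_mono) simp
    hence "int (t * 1) \<le> int (t * (2 * p ^ (h - 1)))" by (simp only: of_nat_le_iff)
    ultimately show ?thesis using assms(8) by (simp add: algebra_simps)
  qed

  \<comment> \<open>Exponents of the evaluation space and their largest weight\<close>
  define J where "J = {..nat l} \<times> ({1..t} \<rightarrow>\<^sub>E {..p - 2})"
  have finJ: "finite J" unfolding J_def by (auto intro: finite_PiE)
  have cardJ: "int (card J) = (l + 1) * (int p - 1) ^ t"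
  proof -
    have "Suc (p - 2) = p - 1" using p2 by simp
    hence "card J = (nat l + 1) * (p - 1) ^ t"
      by (simp add: J_def card_cartesian_product card_PiE)
    thus ?thesis using l0 p2 by (simp add: of_nat_diff algebra_simps)
  qed
  \<comment> \<open>The largest weight in \<open>J\<close>. The choice of \<open>l\<close> makes it
    \<open>p q - 2 t\<close>, so \<open>p^(t-1) N\<close> falls short of \<open>n\<close> by exactly
    the claimed distance bound.\<close>
  define N where "N = p * nat l + m * (t * (p - 2))"
  have key: "p ^ (t - 1) * N + 2 * t * p ^ (t - 1) = p ^ t * p ^ (2 * h)"
  proof -
    have ph: "int p ^ h = int p * int p ^ (h - 1)" using assms(2) by (cases h) auto
    have "int (N + 2 * t) = int p * l + (int p ^ h + 1) * (int t * (int p - 2)) + 2 * int t"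
      using l0 p2 by (simp add: N_def m_def of_nat_diff distrib_right)
    also have "\<dots> = int p * int p ^ (2 * h)"
      unfolding assms(8) ph by (simp add: algebra_simps)
    finally have "int (N + 2 * t) = int (p * p ^ (2 * h))" by simp
    hence *: "N + 2 * t = p * p ^ (2 * h)" by (simp only: of_nat_eq_iff)
    have "p ^ (t - 1) * N + 2 * t * p ^ (t - 1) = p ^ (t - 1) * (N + 2 * t)" by (simp add: algebra_simps)
    also have "\<dots> = (p ^ (t - 1) * p) * p ^ (2 * h)" unfolding * by (simp only: mult.assoc)
    also have "p ^ (t - 1) * p = p ^ t" using assms(5) by (intro power_minus_mult) simp
    finally show ?thesis .
  qed

  \<comment> \<open>Zeros of functions in the evaluation space\<close>
  define mon :: "nat \<times> (nat \<Rightarrow> nat) \<Rightarrow> 'a point \<Rightarrow> 'a" where "mon u = monomial t (fst u) (snd u)" for u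
  have zeros: "card Z \<le> p ^ (t - 1) * N"
    if "Z \<subseteq> B" "\<And>P. P \<in> Z \<Longrightarrow> (\<Sum>u\<in>J. c u * mon u P) = 0" "u \<in> J" "c u \<noteq> 0" for Z c u
  proof (rule card_zeros_bound[where p = p and m = m and a = a and U = J and c = c and ?u0.0 = u])
    show "prime p" "CHAR('a) = p" "\<not> p dvd m" "1 \<le> t" "finite J" "u \<in> J" "c u \<noteq> 0"
      by (fact assms(1) ch m_ndvd assms(5) finJ that(3,4))+
  next
    fix b :: "nat \<Rightarrow> nat" and i
    assume "(\<Sum>i=1..t. of_nat (b i) * a i) = 0" "i \<in> {1..t}"
    thus "(of_nat (b i) :: 'a) = 0" by (rule basis(2))
  next
    show "J \<subseteq> UNIV \<times> ({1..t} \<rightarrow>\<^sub>E {..<p})"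
      unfolding J_def using p2 by (intro Sigma_mono subset_UNIV PiE_mono) auto
  next
    fix j e assume je: "(j, e) \<in> J"
    have "(\<Sum>i=1..t. e i) \<le> of_nat (card {1..t}) * (p - 2)"
      by (rule sum_bounded_above) (use je in \<open>auto simp: J_def PiE_iff\<close>)
    hence "m * (\<Sum>i=1..t. e i) \<le> m * (t * (p - 2))" by (intro mult_left_mono) auto
    moreover have "p * j \<le> p * nat l" using je by (simp add: J_def)
    ultimately show "p * j + m * (\<Sum>i=1..t. e i) \<le> N" unfolding N_def by linarith
  qed (use that Beq Bext finB in \<open>auto simp: mon_def intro: finite_subset\<close>)

  \<comment> \<open>The code as a span of evaluated monomials\<close>
  define g where "g u = evaluation n Q (mon u)" for u
  have g_sum: "(\<Sum>u\<in>J. c u * g u i) = (if i \<in> {1..n} then \<Sum>u\<in>J. c u * mon u (Q i) else 0)" for c i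
    by (cases "i \<in> {1..n}") (simp_all only: g_def evaluation_def if_True if_False mult_zero_right sum.neutral_const)
  have C_eq: "C = {\<lambda>i. \<Sum>u\<in>J. c u * g u i | c. True}"
  proof -
    have "eval_space p t l = {\<lambda>P. \<Sum>u\<in>J. c u * mon u P | c. True}"
      unfolding mon_def by (rule eval_space_eq_sums[OF J_def l0])
    moreover have "(\<lambda>i. \<Sum>u\<in>J. c u * g u i) = evaluation n Q (\<lambda>P. \<Sum>u\<in>J. c u * mon u P)" for c
      by (simp only: g_sum evaluation_def)
    ultimately show ?thesis unfolding assms(9) by auto
  qed
  have C_span: "C = fun_vs.span (g ` J)" unfolding C_eq using span_image_eq_sums[OF finJ] by blast
  have subC: "fun_vs.subspace C" unfolding C_span by (rule fun_vs.subspace_span)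
  have lin: "linear_code n C"
    unfolding linear_code_def using subC by (auto simp: C_eq words_def g_sum)

  \<comment> \<open>Weights, dimension and minimum distance\<close>
  have wt: "2 * t * p ^ (t - 1) \<le> card {i\<in>{1..n}. (\<Sum>u\<in>J. c u * g u i) \<noteq> 0}"
    if "u \<in> J" "c u \<noteq> 0" for c u
  proof -
    define Z0 where "Z0 = {i\<in>{1..n}. (\<Sum>u\<in>J. c u * g u i) = 0}"
    have "card (Q ` Z0) \<le> p ^ (t - 1) * N"
      by (rule zeros[of "Q ` Z0" c u, OF _ _ that]) (auto simp: Z0_def g_sum QB)
    moreover have "card (Q ` Z0) = card Z0"
      by (rule card_image) (rule inj_on_subset[OF injQ], auto simp: Z0_def)
    moreover have "{i\<in>{1..n}. (\<Sum>u\<in>J. c u * g u i) \<noteq> 0} = {1..n} - Z0" by (auto simp: Z0_def)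
    moreover have "card ({1..n} - Z0) = n - card Z0"
      by (subst card_Diff_subset) (auto simp: Z0_def)
    ultimately show ?thesis using key n by simp
  qed
  have pos: "2 * t * p ^ (t - 1) > 0" using assms(5) p2 by simp
  have indep: "c u = 0" if "\<And>i. (\<Sum>u\<in>J. c u * g u i) = 0" "u \<in> J" for c u
  proof (rule ccontr)
    assume "c u \<noteq> 0"
    from wt[of u c, OF that(2) this] show False using that(1) pos by simp
  qed
  have dim: "int (fun_vs.dim C) = (l + 1) * (int p - 1) ^ t"
  proof -
    have "fun_vs.dim (fun_vs.span (g ` J)) = card J"
    proof (rule dim_span_family[OF finJ])
      fix c u assume "\<And>i. (\<Sum>u\<in>J. c u * g u i) = 0" "u \<in> J"
      thus "c u = 0" using indep[of c u] by blast
    qed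
    thus ?thesis using cardJ by (simp add: C_span)
  qed

  have dist: "min_distance n C \<ge> 2 * t * p ^ (t - 1)"
    unfolding min_distance_def
  proof (rule cInf_greatest)
    \<comment> \<open>The index of the constant function 1. Its word is nonzero, so the infimum is
      not taken over the empty set, where it would be 0.\<close>
    define u0 :: "nat \<times> (nat \<Rightarrow> nat)" where "u0 = (0, restrict (\<lambda>_. 0) {1..t})"
    have u0: "u0 \<in> J" by (auto simp: u0_def J_def)
    have "g u0 \<noteq> 0"
    proof
      assume "g u0 = 0"
      have "(\<Sum>u\<in>J. (if u = u0 then 1 else 0) * g u i) = 0" for i
        using \<open>g u0 = 0\<close> by (intro sum.neutral) auto
      from indep[of "\<lambda>u. if u = u0 then 1 else 0", OF this u0] show False by simp
    qed
    moreover have "g u0 \<in> C" "0 \<in> C"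
      using u0 unfolding C_span by (auto intro: fun_vs.span_base fun_vs.span_zero)
    ultimately show "{hamming_dist n u v |u v. u \<in> C \<and> v \<in> C \<and> u \<noteq> v} \<noteq> {}" by blast
  next
    fix d assume "d \<in> {hamming_dist n u v |u v. u \<in> C \<and> v \<in> C \<and> u \<noteq> v}"
    then obtain u v where uv: "u \<in> C" "v \<in> C" "u \<noteq> v" "d = hamming_dist n u v" by auto
    have "u - v \<in> C" using subC uv by (intro fun_vs.subspace_diff)
    then obtain c where c: "u - v = (\<lambda>i. \<Sum>u\<in>J. c u * g u i)" by (auto simp: C_eq)
    have "\<exists>w\<in>J. c w \<noteq> 0"
    proof (rule ccontr)
      assume "\<not> (\<exists>w\<in>J. c w \<noteq> 0)"
      hence "u - v = (\<lambda>i. 0)" unfolding c by simp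
      thus False using uv(3) by (auto simp: fun_eq_iff)
    qed
    then obtain w where "w \<in> J" "c w \<noteq> 0" by auto
    from wt[of w c, OF this] have "2 * t * p ^ (t - 1) \<le> card {i\<in>{1..n}. (u - v) i \<noteq> 0}" by (simp only: c)
    thus "2 * t * p ^ (t - 1) \<le> d" by (simp add: uv(4) hamming_dist_def)
  qed

  \<comment> \<open>Recovery inside the fibers\<close>
  have rec: "recovery_system n C t (\<lambda>_. p - 1) (fiber_recovery_set n t Q)"
    unfolding recovery_system_def
  proof (intro ballI conjI)
    fix i assume i: "i \<in> {1..n}"
    let ?R = "fiber_recovery_set n t Q i"
    show "disjoint_family_on ?R {1..t}"
    proof (unfold disjoint_family_on_def, intro ballI impI equals0I)
      \<comment> \<open>Agreement off \<open>j\<close> and off \<open>j'\<close> together is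
        agreement in all coordinates, which would make \<open>k\<close> equal to
        \<open>i\<close>.\<close>
      fix j j' k assume j: "j \<noteq> j'" and k: "k \<in> ?R j \<inter> ?R j'"
      have kn: "k \<in> {1..n}" "k \<noteq> i" using k by (auto simp: fiber_recovery_set_def)
      have "snd (Q k) x = snd (Q i) x" if "x \<in> {1..t}" for x
        using k j that by (cases "x = j") (auto simp: fiber_recovery_set_def)
      hence "snd (Q k) = snd (Q i)"
        using Bext[OF QB[OF kn(1)]] Bext[OF QB[OF i]] by (intro extensionalityI) auto
      moreover have "fst (Q k) = fst (Q i)" using k by (auto simp: fiber_recovery_set_def)
      ultimately have "Q k = Q i" by (simp add: prod_eq_iff)
      thus False using inj_onD[OF injQ] kn i by blast
    qed
    fix j assume j: "j \<in> {1..t}"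
    show "?R j \<subseteq> {1..n} - {i}" by (auto simp: fiber_recovery_set_def)
    define \<alpha> where "\<alpha> = fst (Q i)"
    define \<beta> where "\<beta> = snd (Q i)"
    \<comment> \<open>The recovery set completed by \<open>i\<close>: the coordinate
      \<open>y_j\<close> identifies it with a full Artin-Schreier fiber, so it has \<open>p\<close>
      elements.\<close>
    define T where "T = insert i (?R j)"
    have T: "k \<in> T \<longleftrightarrow> k \<in> {1..n} \<and> fst (Q k) = \<alpha> \<and> (\<forall>x\<in>{1..t}-{j}. snd (Q k) x = \<beta> x)" for k
      using i by (auto simp: T_def fiber_recovery_set_def \<alpha>_def \<beta>_def)
    have bij: "bij_betw (\<lambda>k. snd (Q k) j) T {y. y ^ p - y = a j * \<alpha> ^ (p ^ h + 1)}"
    proof (rule bij_betw_imageI)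
      show "inj_on (\<lambda>k. snd (Q k) j) T"
      proof (rule inj_onI)
        fix k k' assume k: "k \<in> T" "k' \<in> T" "snd (Q k) j = snd (Q k') j"
        have kn: "k \<in> {1..n}" "k' \<in> {1..n}" using k T by auto
        have "snd (Q k) x = snd (Q k') x" if "x \<in> {1..t}" for x
          using k T that by (cases "x = j") auto
        hence "snd (Q k) = snd (Q k')"
          using Bext[OF QB[OF kn(1)]] Bext[OF QB[OF kn(2)]] by (intro extensionalityI) auto
        moreover have "fst (Q k) = fst (Q k')" using k T by auto
        ultimately have "Q k = Q k'" by (simp add: prod_eq_iff)
        thus "k = k'" using inj_onD[OF injQ] kn by blast
      qed
      show "(\<lambda>k. snd (Q k) j) ` T = {y. y ^ p - y = a j * \<alpha> ^ (p ^ h + 1)}"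
      proof (intro subset_antisym subsetI)
        fix y assume "y \<in> (\<lambda>k. snd (Q k) j) ` T"
        then obtain k where k: "k \<in> T" "y = snd (Q k) j" by auto
        hence "k \<in> {1..n}" "fst (Q k) = \<alpha>" using T by auto
        thus "y \<in> {y. y ^ p - y = a j * \<alpha> ^ (p ^ h + 1)}"
          using Beq[OF QB j, of k] k(2) by (simp add: m_def)
      next
        fix y assume y: "y \<in> {y. y ^ p - y = a j * \<alpha> ^ (p ^ h + 1)}"
        \<comment> \<open>The equations of the other coordinates do not involve \<open>y_j\<close>,
          so it may be replaced by any root over the same \<open>x\<close>.\<close>
        have "(\<alpha>, \<beta>(j := y)) \<in> B"
          using Beq[OF QB[OF i]] Bext[OF QB[OF i]] y j
          by (auto simp: B_def affine_points_def PiE_iff m_def \<alpha>_def \<beta>_def extensional_def)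
        then obtain k where k: "k \<in> {1..n}" "Q k = (\<alpha>, \<beta>(j := y))"
          using assms(7) by (force simp: B_def bij_betw_def)
        hence "k \<in> T" unfolding T by simp
        thus "y \<in> (\<lambda>k. snd (Q k) j) ` T" using k by force
      qed
    qed
    have cardT: "card T = p" using bij_betw_same_card[OF bij] fib[OF j] by simp
    have "i \<notin> ?R j" by (auto simp: fiber_recovery_set_def)
    moreover have "finite (?R j)" by (auto simp: fiber_recovery_set_def)
    ultimately show cR: "card (?R j) = p - 1" using cardT by (simp add: T_def)
    show "recovers C i (?R j)"
    proof (rule recoversI)
      fix c c' assume cc: "c \<in> C" "c' \<in> C" and agree: "\<And>k. k \<in> ?R j \<Longrightarrow> c k = c' k"
      have "c - c' \<in> C" using subC cc by (intro fun_vs.subspace_diff)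
      then obtain d where d: "c - c' = (\<lambda>i. \<Sum>u\<in>J. d u * g u i)" by (auto simp: C_eq)
      \<comment> \<open>On \<open>T\<close> all coordinates except \<open>y_j\<close> are constant,
        so the difference of the words is a polynomial in \<open>y_j\<close>. Its degree is at most
        \<open>p - 2\<close> and it vanishes at the \<open>p - 1\<close> points of the recovery set,
        hence also at \<open>i\<close>.\<close>
      define G where "G = (\<Sum>u\<in>J. monom (d u * \<alpha> ^ fst u * (\<Prod>x\<in>{1..t}-{j}. \<beta> x ^ snd u x)) (snd u j))"
      have G: "(c - c') k = poly G (snd (Q k) j)" if k: "k \<in> T" for k
      proof -
        have "mon u (Q k) = \<alpha> ^ fst u * (\<Prod>x\<in>{1..t}-{j}. \<beta> x ^ snd u x) * snd (Q k) j ^ snd u j" for u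
        proof -
          have "(\<Prod>x\<in>{1..t}-{j}. snd (Q k) x ^ snd u x) = (\<Prod>x\<in>{1..t}-{j}. \<beta> x ^ snd u x)"
            using k T by (intro prod.cong) auto
          moreover have "mon u (Q k) = fst (Q k) ^ fst u * (\<Prod>x\<in>{1..t}. snd (Q k) x ^ snd u x)"
            by (simp add: mon_def monomial_def split: prod.splits)
          moreover have "(\<Prod>x\<in>{1..t}. snd (Q k) x ^ snd u x)
              = snd (Q k) j ^ snd u j * (\<Prod>x\<in>{1..t}-{j}. snd (Q k) x ^ snd u x)"
            using j by (intro prod.remove) auto
          ultimately show ?thesis using k T by simp
        qed
        thus ?thesis using k T unfolding d G_def g_sum
          by (simp add: poly_sum poly_monom mult.assoc)
      qed
      have "degree G \<le> p - 2"
        unfolding G_def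
      proof (rule degree_sum_le[OF finJ])
        fix u assume "u \<in> J"
        hence "snd u j \<le> p - 2" using j by (auto simp: J_def PiE_iff)
        thus "degree (monom (d u * \<alpha> ^ fst u * (\<Prod>x\<in>{1..t}-{j}. \<beta> x ^ snd u x)) (snd u j)) \<le> p - 2"
          by (meson degree_monom_le order_trans)
      qed
      moreover have "card ((\<lambda>k. snd (Q k) j) ` ?R j) = p - 1"
        using bij cR by (subst card_image) (auto simp: bij_betw_def T_def intro: inj_on_subset)
      moreover have "poly G (snd (Q k) j) = 0" if "k \<in> ?R j" for k
        using G[of k] agree[OF that] that by (simp add: T_def)
      ultimately have "G = 0" using p2
        by (intro poly_eq_0_if_card_roots_gt_degree[of G "(\<lambda>k. snd (Q k) j) ` ?R j"]) auto
      hence "(c - c') i = 0" using G[of i] by (simp add: T_def)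
      thus "c i = c' i" by simp
    qed
  qed
  hence "has_availability_locality n C t (\<lambda>_. p - 1)"
    unfolding has_availability_locality_def by blast
  thus ?thesis using lin n dim dist rec assms(8) by simp
qed

end
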